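(* Let $f$ be a probability distribution (density) on $\mathbb{R}$, and set, for a packed word $u$ of length $n$, $$m_u(f)=(-1)^{\max(u)}\int_{K_u}f(x_1)\cdots f(x_n)\,dx_1\cdots dx_n .$$ Then $m_u(f)$ depends only on the integer composition $I=\mathrm{ev}(u)$, so that it can be denoted by $m_I$ as well. The formal series $$S(f):=\sum_u m_u\,\mathbf{N}_u$$ is grouplike for the coproduct of $\mathbf{WQSym}^*$. If one embeds $\mathbf{Sym}$ in $\mathbf{WQSym}^*$ by $S^I\mapsto\sum_{\mathrm{ev}(u)=I}\mathbf{N}_u$, then $$S(f)=\sum_I m_I\,S^I,$$ and this series is grouplike in $\mathbf{Sym}$ (that is, $m_I=\chi(M_I)$ for some character $\chi$ of $QSym$).
   Context: Packed words: a word $u$ over the positive integers is packed if its set of letters is $\{1,\dots,r\}$, $r=\max(u)$ (the empty word is packed, $\max=0$, and $m_\emptyset=1$). $\mathrm{ev}(u)=(|u|_1,\dots,|u|_r)$, where $|u|_i$ is the number of occurrences of $i$ in $u$. $\mathrm{pack}(w)$ replaces the distinct letters $b_1<\dots<b_r$ of a word $w$ by $1,\dots,r$. $u$ of length $n$ encodes the set composition $(B_1,\dots,B_r)$ of $\{1,\dots,n\}$, $B_k$ being the set of positions of the letter $k$; $K_u\subset\mathbb{R}^n$ is the cone defined by $\sum_{j=1}^k\sum_{i\in B_j}x_i\ge0$, $k=1,\dots,r$. $\mathbf{WQSym}$ (over $\mathbb{R}$): graded Hopf algebra with basis $\mathbf{M}_u=\sum_{\mathrm{pack}(w)=u}w$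 (sum over words over an infinite totally ordered alphabet $A$ of noncommuting variables), with product $\mathbf{M}_u\mathbf{M}_v=\sum_w c_{uv}^w\mathbf{M}_w$ where $c_{uv}^w=1$ if $w$ is packed and $w=w'w''$ with $\mathrm{pack}(w')=u$, $\mathrm{pack}(w'')=v$, and $0$ otherwise; the coproduct is $A\mapsto A+B$ (ordinal sum of two copies of the alphabet, commuting with each other). $\mathbf{WQSym}^*$ is its graded dual, $\mathbf{N}_u$ the basis dual to $\mathbf{M}_u$, so $\Delta\mathbf{N}_w=\sum_{u,v}c_{uv}^w\mathbf{N}_u\otimes\mathbf{N}_v$. Infinite sums are taken in completions. A series $G$ with constant term $1$ is grouplike if $\Delta G=G\otimes G$. $\mathbf{Sym}=\mathbb{R}\langle S_1,S_2,\dots\rangle$ is the free associative algebra with $\Delta S_n=\sum_{k=0}^nS_k\otimes S_{n-k}$ ($S_0=1$) and $S^I=S_{i_1}\cdots S_{i_r}$ for a composition $I$. $QSym$ is the algebra of quasi-symmetric functions with monomial basis $M_I=\sum_{k_1<\dots<k_r}x_{k_1}^{i_1}\cdots x_{k_r}^{i_r}$, dual to $\mathbf{Sym}$ via $\langle M_I,S^J\rangle=\delta_{IJ}$; a character of $QSym$ is a (unital) algebra morphism $QSym\to\mathbb{R}$. *)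

theory Defs
  imports "HOL-Analysis.Analysis" "HOL-Library.Poly_Mapping"
begin

section \<open>Formal series over a basis\<close>

text \<open>
  An element of the completion of a graded vector space with homogeneous basis indexed by \<open>'b\<close>
  is the family of its coefficients, a function \<open>'b \<Rightarrow> real\<close>; the completed tensor square has
  basis indexed by \<open>'b \<times> 'b\<close>.  \<open>formal_sum a \<phi>\<close> is the series \<open>\<Sum>\<^sub>b a\<^sub>b \<phi>\<^sub>b\<close>: every coefficient is
  a finite sum as soon as the family \<open>\<phi>\<close> is locally finite, which holds in each use below (for
  the coproducts see \<open>finite_wqsym_struct\<close> and \<open>finite_sym_coprod_S\<close>).
\<close>

definition formal_sum :: "('b \<Rightarrow> real) \<Rightarrow> ('b \<Rightarrow> 'c \<Rightarrow> real) \<Rightarrow> 'c \<Rightarrow> real" where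
  "formal_sum a \<phi> = (\<lambda>c. Sum_any (\<lambda>b. a b * \<phi> b c))"

definition tensor :: "('b \<Rightarrow> real) \<Rightarrow> ('c \<Rightarrow> real) \<Rightarrow> 'b \<times> 'c \<Rightarrow> real" where
  "tensor G H = (\<lambda>(b, c). G b * H c)"

text \<open>\<open>\<Delta>\<close> is a coproduct, \<open>e\<close> the index of the basis element \<open>1\<close>.\<close>

definition grouplike :: "(('b \<Rightarrow> real) \<Rightarrow> 'b \<times> 'b \<Rightarrow> real) \<Rightarrow> 'b \<Rightarrow> ('b \<Rightarrow> real) \<Rightarrow> bool" where
  "grouplike \<Delta> e G \<longleftrightarrow> G e = 1 \<and> \<Delta> G = tensor G G"


section \<open>Integer compositions and packed words\<close>

typedef composition = "{I :: nat list. 0 \<notin> set I}" morphisms parts Composition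
  by (rule exI[of _ "[]"]) simp

setup_lifting type_definition_composition

text \<open>Concatenation is written additively so that \<open>composition \<Rightarrow>\<^sub>0 real\<close> is a monoid algebra.\<close>

instantiation composition :: monoid_add
begin

lift_definition zero_composition :: composition is "[]" by simp

lift_definition plus_composition :: "composition \<Rightarrow> composition \<Rightarrow> composition" is append by simp

instance by standard (transfer; simp)+

end

definition max_letter :: "nat list \<Rightarrow> nat" where
  "max_letter u = Max (insert 0 (set u))"

definition packed :: "nat list \<Rightarrow> bool" where
  "packed u \<longleftrightarrow> set u = {1..max_letter u}"

definition pack :: "'a::linorder list \<Rightarrow> nat list" where
  "pack w = map (\<lambda>a. card {b \<in> set w. b \<le> a}) w"

typedef packed_word = "{u. packed u}" morphisms letters Packed_word
  by (rule exI[of _ "[]"]) (simp add: packed_def max_letter_def)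

setup_lifting type_definition_packed_word

lift_definition empty_word :: packed_word is "[]"
  by (simp add: packed_def max_letter_def)

lift_definition ev :: "packed_word \<Rightarrow> composition" is
  "\<lambda>u. map (count_list u) [1..<Suc (max_letter u)]"
  by (auto simp: packed_def count_list_0_iff)


section \<open>The numbers \<open>m\<^sub>u(f)\<close>\<close>

text \<open>Positions are numbered from \<open>0\<close>: \<open>\<real>\<^sup>n\<close> is the product of copies of \<open>\<real>\<close> indexed by
  \<open>{..<n}\<close>.\<close>

definition block :: "packed_word \<Rightarrow> nat \<Rightarrow> nat set" where
  "block u k = {i. i < length (letters u) \<and> letters u ! i = k}"

definition cone :: "packed_word \<Rightarrow> (nat \<Rightarrow> real) set" where
  "cone u = {x \<in> {..<length (letters u)} \<rightarrow>\<^sub>E UNIV.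
     \<forall>k\<in>{1..max_letter (letters u)}. 0 \<le> (\<Sum>j=1..k. \<Sum>i\<in>block u j. x i)}"

definition m_word :: "(real \<Rightarrow> real) \<Rightarrow> packed_word \<Rightarrow> real" where
  "m_word f u = (-1) ^ max_letter (letters u) *
     (LINT x:cone u|PiM {..<length (letters u)} (\<lambda>_. lborel). \<Prod>i<length (letters u). f (x i))"

text \<open>The common value of \<open>m\<^sub>u(f)\<close> for the packed words \<open>u\<close> of evaluation \<open>I\<close>, of which there is
  always at least one (\<open>surj_ev\<close>).\<close>

definition m_comp :: "(real \<Rightarrow> real) \<Rightarrow> composition \<Rightarrow> real" where
  "m_comp f I = (THE c. \<forall>u. ev u = I \<longrightarrow> m_word f u = c)"


section \<open>The completed graded dual of \<open>WQSym\<close>\<close>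

text \<open>Elements are series \<open>packed_word \<Rightarrow> real\<close> in the basis \<open>N\<^sub>u\<close>.  The coefficient of \<open>M\<^sub>w\<close> in
  \<open>M\<^sub>u M\<^sub>v\<close> is also the coefficient of \<open>N\<^sub>u \<otimes> N\<^sub>v\<close> in \<open>\<Delta> N\<^sub>w\<close>.\<close>

definition wqsym_struct :: "packed_word \<Rightarrow> packed_word \<Rightarrow> packed_word \<Rightarrow> real" where
  "wqsym_struct u v w =
     (if \<exists>w' w''. letters w = w' @ w'' \<and> pack w' = letters u \<and> pack w'' = letters v then 1 else 0)"

definition wqsym_N :: "packed_word \<Rightarrow> packed_word \<Rightarrow> real" where
  "wqsym_N u = (\<lambda>v. if v = u then 1 else 0)"

definition wqsym_coprod_N :: "packed_word \<Rightarrow> packed_word \<times> packed_word \<Rightarrow> real" where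
  "wqsym_coprod_N w = (\<lambda>(u, v). wqsym_struct u v w)"

definition wqsym_coprod :: "(packed_word \<Rightarrow> real) \<Rightarrow> packed_word \<times> packed_word \<Rightarrow> real" where
  "wqsym_coprod G = formal_sum G wqsym_coprod_N"

definition wqsym_series :: "(real \<Rightarrow> real) \<Rightarrow> packed_word \<Rightarrow> real" where
  "wqsym_series f = formal_sum (m_word f) wqsym_N"


section \<open>The Hopf algebra \<open>Sym\<close> and its completion\<close>

text \<open>The free associative algebra on \<open>S\<^sub>1, S\<^sub>2, \<dots>\<close> is the monoid algebra of the monoid of
  compositions, and its tensor square is the monoid algebra of the direct product of this
  monoid with itself.\<close>

lift_definition one_part :: "nat \<Rightarrow> composition" is "\<lambda>n. if n = 0 then [] else [n]"
  by simp

definition sym_S :: "nat \<Rightarrow> composition \<Rightarrow>\<^sub>0 real" where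
  "sym_S n = Poly_Mapping.single (one_part n) 1"

definition sym_S_comp :: "composition \<Rightarrow> composition \<Rightarrow>\<^sub>0 real" where
  "sym_S_comp I = prod_list (map sym_S (parts I))"

text \<open>\<open>\<Delta> S\<^sub>n = \<Sum>\<^sub>k S\<^sub>k \<otimes> S\<^sub>n\<^sub>-\<^sub>k\<close>, extended multiplicatively to the \<open>S\<^sup>I\<close>.\<close>

definition sym_coprod_gen :: "nat \<Rightarrow> composition \<times> composition \<Rightarrow>\<^sub>0 real" where
  "sym_coprod_gen n = (\<Sum>k\<le>n. Poly_Mapping.single (one_part k, one_part (n - k)) 1)"

definition sym_coprod_S :: "composition \<Rightarrow> composition \<times> composition \<Rightarrow>\<^sub>0 real" where
  "sym_coprod_S I = prod_list (map sym_coprod_gen (parts I))"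

text \<open>Elements of the completion are series \<open>composition \<Rightarrow> real\<close> in the basis \<open>S\<^sup>I\<close>.\<close>

definition sym_coprod :: "(composition \<Rightarrow> real) \<Rightarrow> composition \<times> composition \<Rightarrow> real" where
  "sym_coprod G = formal_sum G (\<lambda>I. Poly_Mapping.lookup (sym_coprod_S I))"

definition sym_series :: "(real \<Rightarrow> real) \<Rightarrow> composition \<Rightarrow> real" where
  "sym_series f = formal_sum (m_comp f) (\<lambda>I. Poly_Mapping.lookup (sym_S_comp I))"

text \<open>The embedding of \<open>Sym\<close> into the dual of \<open>WQSym\<close>, extended to the completions.\<close>

definition sym_embed_S :: "composition \<Rightarrow> packed_word \<Rightarrow> real" where
  "sym_embed_S I = formal_sum (\<lambda>u. if ev u = I then 1 else 0) wqsym_N"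

definition sym_embed :: "(composition \<Rightarrow> real) \<Rightarrow> packed_word \<Rightarrow> real" where
  "sym_embed G = formal_sum G sym_embed_S"


section \<open>Quasi-symmetric functions\<close>

text \<open>Formal power series in commuting variables \<open>x\<^sub>0, x\<^sub>1, \<dots>\<close>: coefficient functions on
  monomials, a monomial being its finitely supported exponent function.\<close>

type_synonym power_series = "(nat \<Rightarrow>\<^sub>0 nat) \<Rightarrow> real"

definition ps_mult :: "power_series \<Rightarrow> power_series \<Rightarrow> power_series" where
  "ps_mult F G = (\<lambda>m. \<Sum>(a, b)\<in>{(a, b). a + b = m}. F a * G b)"

definition ps_one :: power_series where
  "ps_one = (\<lambda>m. if m = 0 then 1 else 0)"

text \<open>The coefficient of a monomial in \<open>M\<^sub>I\<close> counts the sequences \<open>k\<^sub>1 < \<dots> < k\<^sub>r\<close> that produce it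
  (there is at most one).\<close>

definition qsym_M :: "composition \<Rightarrow> power_series" where
  "qsym_M I = (\<lambda>m. real (card {ks. length ks = length (parts I) \<and> sorted_wrt (<) ks \<and>
     m = (\<Sum>j<length ks. Poly_Mapping.single (ks ! j) (parts I ! j))}))"

definition QSym :: "power_series set" where
  "QSym = {F. \<exists>c :: composition \<Rightarrow>\<^sub>0 real.
     F = (\<lambda>m. \<Sum>I\<in>Poly_Mapping.keys c. Poly_Mapping.lookup c I * qsym_M I m)}"

text \<open>Only the values of \<open>\<psi>\<close> on \<open>QSym\<close> matter.\<close>

definition qsym_character :: "(power_series \<Rightarrow> real) \<Rightarrow> bool" where
  "qsym_character \<psi> \<longleftrightarrow>
     (\<forall>F\<in>QSym. \<forall>G\<in>QSym. \<psi> (\<lambda>m. F m + G m) = \<psi> F + \<psi> G) \<and>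
     (\<forall>a. \<forall>F\<in>QSym. \<psi> (\<lambda>m. a * F m) = a * \<psi> F) \<and>
     \<psi> ps_one = 1 \<and>
     (\<forall>F\<in>QSym. \<forall>G\<in>QSym. \<psi> (ps_mult F G) = \<psi> F * \<psi> G)"


section \<open>Well-definedness of the constructions\<close>

lemma length_pack: "length (pack w) = length w"
  by (simp add: pack_def)

lemma finite_packed_words: "finite {w. length (letters w) = n}"
proof -
  have "letters ` {w. length (letters w) = n} \<subseteq> {xs. set xs \<subseteq> {..n} \<and> length xs = n}"
  proof clarsimp
    fix w x assume x: "x \<in> set (letters w)" and n: "n = length (letters w)"
    have "packed (letters w)" using letters by blast
    then have s: "set (letters w) = {1..max_letter (letters w)}" by (simp add: packed_def)
    have "max_letter (letters w) = card (set (letters w))" by (subst s) simp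
    also have "\<dots> \<le> length (letters w)" by (rule card_length)
    finally show "x \<le> length (letters w)" using x s by auto
  qed
  then have "finite (letters ` {w. length (letters w) = n})"
    using finite_lists_length_eq[of "{..n}" n] finite_subset by blast
  then show ?thesis
    by (rule finite_imageD) (auto simp: inj_on_def letters_inject)
qed

lemma finite_wqsym_struct: "finite {w. wqsym_struct u v w \<noteq> 0}"
proof (rule finite_subset[OF _ finite_packed_words])
  show "{w. wqsym_struct u v w \<noteq> 0} \<subseteq>
      {w. length (letters w) = length (letters u) + length (letters v)}"
    by (auto simp: wqsym_struct_def split: if_splits) (metis length_append length_pack)
qed

lemma finite_compositions: "finite {I. sum_list (parts I) = n}"
proof -
  have "parts ` {I. sum_list (parts I) = n} \<subseteq> {xs. set xs \<subseteq> {..n} \<and> length xs \<le> n}"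
  proof clarsimp
    fix I assume n: "n = sum_list (parts I)"
    have "0 \<notin> set (parts I)" using parts by blast
    moreover have "0 \<notin> set xs \<Longrightarrow> length xs \<le> sum_list xs" for xs :: "nat list"
      by (induction xs) auto
    ultimately have "length (parts I) \<le> sum_list (parts I)" by blast
    then show "set (parts I) \<subseteq> {..sum_list (parts I)} \<and> length (parts I) \<le> sum_list (parts I)"
      using member_le_sum_list by auto
  qed
  then have "finite (parts ` {I. sum_list (parts I) = n})"
    using finite_lists_length_le[of "{..n}" n] finite_subset by blast
  then show ?thesis
    by (rule finite_imageD) (auto simp: inj_on_def parts_inject)
qed

lemma sum_list_parts_plus [simp]: "sum_list (parts (I + J)) = sum_list (parts I) + sum_list (parts J)"
  by transfer simp

lemma sum_list_parts_one_part [simp]: "sum_list (parts (one_part n)) = n"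
  by transfer simp

lemma sum_list_parts_zero [simp]: "sum_list (parts 0) = 0"
  by transfer simp

lemma keys_prod_sym_coprod_gen:
  "(J, K) \<in> Poly_Mapping.keys (prod_list (map sym_coprod_gen xs)) \<Longrightarrow>
     sum_list (parts J) + sum_list (parts K) = sum_list xs"
proof (induction xs arbitrary: J K)
  case Nil
  then show ?case by (simp add: zero_prod_def)
next
  case (Cons n xs)
  let ?q = "prod_list (map sym_coprod_gen xs)"
  from Cons.prems have "(J, K) \<in> Poly_Mapping.keys (sym_coprod_gen n * ?q)" by simp
  then obtain a b where ab: "(J, K) = a + b" "a \<in> Poly_Mapping.keys (sym_coprod_gen n)" "b \<in> Poly_Mapping.keys ?q"
    using keys_mult by blast
  have "Poly_Mapping.keys (sym_coprod_gen n) \<subseteq>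
      (\<Union>k\<in>{..n}. Poly_Mapping.keys (Poly_Mapping.single (one_part k, one_part (n - k)) (1::real)))"
    unfolding sym_coprod_gen_def by (rule keys_sum)
  then obtain k where k: "k \<le> n" "a = (one_part k, one_part (n - k))"
    using ab(2) by (auto split: if_splits)
  obtain J' K' where b: "b = (J', K')" by force
  have "J = one_part k + J'" "K = one_part (n - k) + K'"
    using ab(1) k(2) b by auto
  moreover have "sum_list (parts J') + sum_list (parts K') = sum_list xs"
    using Cons.IH ab(3) b by blast
  ultimately show ?case using k(1) by simp
qed

lemma finite_sym_coprod_S: "finite {I. Poly_Mapping.lookup (sym_coprod_S I) (J, K) \<noteq> 0}"
proof (rule finite_subset[OF _ finite_compositions])
  show "{I. Poly_Mapping.lookup (sym_coprod_S I) (J, K) \<noteq> 0} \<subseteq>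
      {I. sum_list (parts I) = sum_list (parts J) + sum_list (parts K)}"
    using keys_prod_sym_coprod_gen by (auto simp: sym_coprod_S_def in_keys_iff)
qed

lemma sym_S_comp_eq: "sym_S_comp I = Poly_Mapping.single I 1"
proof -
  have "0 \<notin> set xs \<Longrightarrow> prod_list (map sym_S xs) = Poly_Mapping.single (Composition xs) 1" for xs
  proof (induction xs)
    case Nil
    then show ?case by (simp flip: zero_composition_def)
  next
    case (Cons n xs)
    then have "one_part n + Composition xs = Composition (n # xs)"
      by (simp add: one_part_def plus_composition_def Composition_inverse)
    with Cons show ?case by (simp add: sym_S_def mult_single)
  qed
  from this[of "parts I"] show ?thesis
    using parts[of I] by (simp add: sym_S_comp_def parts_inverse)
qed

lemma finite_ps_mult: "finite {(a, b). a + b = (m :: nat \<Rightarrow>\<^sub>0 nat)}"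
proof -
  have fin: "finite {a. \<exists>b. a + b = m}"
  proof -
    let ?B = "{..Max (insert 0 (Poly_Mapping.lookup m ` Poly_Mapping.keys m))}"
    have "Poly_Mapping.lookup a x \<in> ?B" "x \<notin> Poly_Mapping.keys m \<Longrightarrow> Poly_Mapping.lookup a x = 0"
      if "a + b = m" for a b x
    proof -
      have le: "Poly_Mapping.lookup a x \<le> Poly_Mapping.lookup m x"
        using that by (auto simp: lookup_add)
      then show "x \<notin> Poly_Mapping.keys m \<Longrightarrow> Poly_Mapping.lookup a x = 0"
        by (simp add: in_keys_iff)
      show "Poly_Mapping.lookup a x \<in> ?B"
      proof (cases "x \<in> Poly_Mapping.keys m")
        case True
        then have "Poly_Mapping.lookup m x
            \<le> Max (insert 0 (Poly_Mapping.lookup m ` Poly_Mapping.keys m))"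
          by (intro Max_ge) auto
        with le show ?thesis by simp
      next
        case False
        with le show ?thesis by (simp add: in_keys_iff)
      qed
    qed
    then have "Poly_Mapping.lookup ` {a. \<exists>b. a + b = m} \<subseteq>
        {g. \<forall>x. (x \<in> Poly_Mapping.keys m \<longrightarrow> g x \<in> ?B) \<and> (x \<notin> Poly_Mapping.keys m \<longrightarrow> g x = 0)}"
      by (auto simp del: atMost_iff)
    then have "finite (Poly_Mapping.lookup ` {a. \<exists>b. a + b = m})"
      by (rule finite_subset) (intro finite_set_of_finite_funs; simp)
    then show ?thesis
      by (rule finite_imageD) (auto simp: inj_on_def lookup_inject)
  qed
  have "{(a, b). a + b = m} \<subseteq> (\<lambda>a. (a, m - a)) ` {a. \<exists>b. a + b = m}"
    by auto
  with fin show ?thesis using finite_subset by blast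
qed

lemma surj_ev: "surj ev"
proof -
  define W :: "nat list \<Rightarrow> nat list"
    where "W xs = concat (map (\<lambda>k. replicate (xs ! k) (Suc k)) [0..<length xs])" for xs
  have W: "set (W xs) = {1..length xs}" "max_letter (W xs) = length xs"
    "map (count_list (W xs)) [1..<Suc (length xs)] = xs" if "0 \<notin> set xs" for xs
  proof -
    have pos: "xs ! k > 0" if "k < length xs" for k
      using \<open>0 \<notin> set xs\<close> that by (metis gr0I nth_mem)
    show s: "set (W xs) = {1..length xs}"
    proof -
      have "set (W xs) = (\<Union>k\<in>{0..<length xs}. set (replicate (xs ! k) (Suc k)))"
        by (simp add: W_def)
      also have "\<dots> = (\<Union>k\<in>{0..<length xs}. {Suc k})"
        using pos by (intro SUP_cong) auto
      also have "\<dots> = Suc ` {0..<length xs}" by blast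
      also have "\<dots> = {1..length xs}"
        by (simp only: image_Suc_atLeastLessThan One_nat_def atLeastLessThanSuc_atLeastAtMost)
      finally show ?thesis .
    qed
    show "max_letter (W xs) = length xs"
      unfolding max_letter_def s by (rule Max_eqI) (cases xs; auto)+
    have rep: "count_list (replicate n a) b = (if a = b then n else 0)" for n and a b :: nat
      by (induction n) auto
    have "count_list (concat (map (\<lambda>k. replicate (xs ! k) (Suc k)) [0..<n])) (Suc i) =
        (if i < n then xs ! i else 0)" for n i
      by (induction n) (auto simp: less_Suc_eq count_list_0_iff rep)
    then show "map (count_list (W xs)) [1..<Suc (length xs)] = xs"
      by (intro nth_equalityI) (auto simp: W_def simp del: upt_Suc)
  qed
  have "\<exists>u. ev u = I" for I
  proof -
    have "0 \<notin> set (parts I)" using parts by blast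
    note W = W[OF this]
    have "letters (Packed_word (W (parts I))) = W (parts I)"
      by (rule Packed_word_inverse) (simp add: packed_def W)
    then have "parts (ev (Packed_word (W (parts I)))) = parts I"
      by (simp only: ev.rep_eq W)
    then show ?thesis using parts_inject by blast
  qed
  then show ?thesis by (metis surjI)
qed

lemma sym_embed_eq: "sym_embed G u = G (ev u)"
proof -
  have "sym_embed_S I u = (if ev u = I then 1 else 0)" for I
  proof -
    have "sym_embed_S I u = Sum_any (\<lambda>v. if u = v then (if ev u = I then 1 else 0) else 0)"
      unfolding sym_embed_S_def formal_sum_def wqsym_N_def
      by (intro Sum_any.cong) auto
    then show ?thesis by simp
  qed
  then have "sym_embed G u = Sum_any (\<lambda>I. if ev u = I then G I else 0)"
    unfolding sym_embed_def formal_sum_def by (intro Sum_any.cong) auto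
  then show ?thesis by simp
qed

lemma inj_sym_embed: "inj sym_embed"
proof (rule injI)
  fix G H assume "sym_embed G = sym_embed H"
  then have "G (ev u) = H (ev u)" for u by (metis sym_embed_eq)
  then show "G = H" using surj_ev by (metis ext surjD)
qed

end

theory Submission
  imports Defs "HOL-Probability.Infinite_Product_Measure"
begin

text \<open>
  Write \<open>[P]\<close> for \<open>1\<close> if \<open>P\<close> holds and \<open>0\<close> otherwise.  Everything rests on one identity between
  real numbers \<open>a\<close>, \<open>b\<close>:
  \<open>[a \<ge> 0] [b \<ge> 0] = [a + b \<ge> 0] ([a \<ge> 0] + [b \<ge> 0] - 1)\<close>.
  It says that restriction to the nonnegative half-line is a Rota-Baxter operator, and nested
  Rota-Baxter operators multiply, up to signs, by the quasi-shuffle rule of the \<open>M\<^sub>I\<close>.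

  Let \<open>a\<^sub>1, \<dots>, a\<^sub>r\<close> be the sums of the coordinates of \<open>x\<close> over the first \<open>1, \<dots>, r\<close> blocks of \<open>u\<close>,
  and \<open>b\<^sub>1, \<dots>, b\<^sub>s\<close> those of \<open>y\<close> over the blocks of \<open>v\<close>; put \<open>a\<^sub>0 = b\<^sub>0 = 0\<close>.  A word \<open>w = w'w''\<close> occurring in \<open>M\<^sub>u M\<^sub>v\<close> is
  determined by the letter sets \<open>A\<close>, \<open>B\<close> of \<open>w'\<close>, \<open>w''\<close>, which cover \<open>{1..max w}\<close>; and the \<open>k\<close>-th
  inequality of its cone is \<open>a\<^sub>i + b\<^sub>j \<ge> 0\<close> with \<open>i\<close>, \<open>j\<close> the numbers of elements of \<open>A\<close>, \<open>B\<close> up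
  to \<open>k\<close>.  Removing the largest letter of \<open>w\<close> (which lies in \<open>A\<close> only, in \<open>B\<close> only, or in both) and
  applying the identity to \<open>a\<^sub>r\<close>, \<open>b\<^sub>s\<close> shows by induction that the signed indicator functions of the
  cones satisfy \<open>\<Sum>\<^sub>w (-1)\<^bsup>max w\<^esup> [(x, y) \<in> K\<^sub>w] = (-1)\<^bsup>max u + max v\<^esup> [x \<in> K\<^sub>u] [y \<in> K\<^sub>v]\<close>, at every
  point and not just almost everywhere (\<open>sum_seq_cone\<close>).  Integrating this over independent
  coordinates of density \<open>f\<close> gives \<open>\<Sum>\<^sub>w m\<^sub>w = m\<^sub>u m\<^sub>v\<close> (\<open>m_word_mult\<close>), which is grouplikeness over
  the dual of \<open>WQSym\<close>.  Since independent identically distributed coordinates may be permuted,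
  \<open>m\<^sub>u\<close> depends on \<open>ev u\<close> only.

  The passage to \<open>Sym\<close> and \<open>QSym\<close> is a comparison of structure constants.  The coefficient of
  \<open>S\<^sup>J \<otimes> S\<^sup>K\<close> in \<open>\<Delta> S\<^sup>I\<close> counts the ways to write \<open>I = k + l\<close> entrywise with \<open>k\<close>, \<open>l\<close> reducing to
  \<open>J\<close>, \<open>K\<close> when their zeros are erased.  The words \<open>w\<close> of evaluation \<open>I\<close> in \<open>M\<^sub>u M\<^sub>v\<close> are counted by
  the same numbers, \<open>k\<close> and \<open>l\<close> being the letter counts of \<open>w'\<close> and \<open>w''\<close> (\<open>card_struct_ev\<close>); so are
  the factorizations of a monomial with exponents \<open>I\<close> into monomials of \<open>M\<^sub>J\<close> and \<open>M\<^sub>K\<close>, \<open>k\<close> and \<open>l\<close>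
  being the exponents of the factors (\<open>card_factorizations\<close>).
\<close>

section \<open>Cones on the sequence space\<close>

definition partial_sum :: "nat list \<Rightarrow> (nat \<Rightarrow> real) \<Rightarrow> nat \<Rightarrow> real" where
  "partial_sum u x k = (\<Sum>i | i < length u \<and> u ! i \<le> k. x i)"

text \<open>
  The cone of a word, as a condition on infinite sequences that involves finitely many coordinates
  only: words of all lengths then define events in one probability space.
\<close>

definition seq_cone :: "nat list \<Rightarrow> (nat \<Rightarrow> real) set" where
  "seq_cone u = {x. \<forall>k\<in>{1..max_letter u}. 0 \<le> partial_sum u x k}"

lemma packed_letters: "packed (letters u)"
  using letters by blast

lemma set_letters: "set (letters u) = {1..max_letter (letters u)}"
  using packed_letters by (simp add: packed_def)

lemma letters_nth_ge_1: "i < length (letters u) \<Longrightarrow> 1 \<le> letters u ! i"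
  using nth_mem[of i "letters u"] by (auto simp: set_letters simp del: nth_mem)

lemma cone_eq_seq_cone:
  "cone u = seq_cone (letters u) \<inter> ({..<length (letters u)} \<rightarrow>\<^sub>E UNIV)"
proof -
  have "(\<Sum>j=1..k. \<Sum>i\<in>block u j. x i) = partial_sum (letters u) x k" for k and x :: "nat \<Rightarrow> real"
  proof -
    have "(\<Sum>j=1..k. \<Sum>i\<in>block u j. x i) = sum x (\<Union>j\<in>{1..k}. block u j)"
      by (rule sum.UNION_disjoint[symmetric]) (auto simp: block_def)
    also have "(\<Union>j\<in>{1..k}. block u j) = {i. i < length (letters u) \<and> letters u ! i \<le> k}"
      using letters_nth_ge_1[of _ u] by (auto simp: block_def)
    finally show ?thesis by (simp add: partial_sum_def)
  qed
  then show ?thesis by (auto simp: cone_def seq_cone_def)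
qed

lemma partial_sum_cong:
  "(\<And>i. i < length u \<Longrightarrow> x i = y i) \<Longrightarrow> partial_sum u x k = partial_sum u y k"
  unfolding partial_sum_def by (rule sum.cong) auto

lemma seq_cone_cong:
  "(\<And>i. i < length u \<Longrightarrow> x i = y i) \<Longrightarrow> x \<in> seq_cone u \<longleftrightarrow> y \<in> seq_cone u"
  using partial_sum_cong[of u x y] by (auto simp: seq_cone_def)

section \<open>The distribution of independent coordinates\<close>

lemma PiM_density:
  fixes f :: "'a \<Rightarrow> ennreal"
  assumes "sigma_finite_measure N" "sigma_finite_measure (density N f)"
    and [measurable]: "f \<in> borel_measurable N" and fin: "finite I"
  shows "PiM I (\<lambda>_. density N f) = density (PiM I (\<lambda>_. N)) (\<lambda>x. \<Prod>i\<in>I. f (x i))"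
proof -
  interpret N: product_sigma_finite "\<lambda>_. N" by (simp add: product_sigma_finite_def assms)
  interpret D: product_sigma_finite "\<lambda>_. density N f"
    by (simp add: product_sigma_finite_def assms)
  show ?thesis
  proof (rule D.PiM_eqI[OF fin, symmetric])
    show "sets (density (PiM I (\<lambda>_. N)) (\<lambda>x. \<Prod>i\<in>I. f (x i))) = sets (PiM I (\<lambda>_. density N f))"
      by (simp cong: sets_PiM_cong)
    fix A assume A: "\<And>i. i \<in> I \<Longrightarrow> A i \<in> sets (density N f)"
    then have [measurable]: "\<And>i. i \<in> I \<Longrightarrow> A i \<in> sets N" by simp
    have "emeasure (density (PiM I (\<lambda>_. N)) (\<lambda>x. \<Prod>i\<in>I. f (x i))) (Pi\<^sub>E I A) =
        (\<integral>\<^sup>+x. (\<Prod>i\<in>I. f (x i)) * indicator (Pi\<^sub>E I A) x \<partial>PiM I (\<lambda>_. N))"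
      using fin by (intro emeasure_density) (auto intro!: sets_PiM_I_finite A)
    also have "\<dots> = (\<integral>\<^sup>+x. (\<Prod>i\<in>I. f (x i) * indicator (A i) (x i)) \<partial>PiM I (\<lambda>_. N))"
    proof (rule nn_integral_cong)
      fix x assume "x \<in> space (PiM I (\<lambda>_. N))"
      then have "indicator (Pi\<^sub>E I A) x = (\<Prod>i\<in>I. indicator (A i) (x i) :: ennreal)"
        using fin by (auto simp: indicator_def space_PiM PiE_iff)
      then show "(\<Prod>i\<in>I. f (x i)) * indicator (Pi\<^sub>E I A) x = (\<Prod>i\<in>I. f (x i) * indicator (A i) (x i))"
        by (simp add: prod.distrib)
    qed
    also have "\<dots> = (\<Prod>i\<in>I. \<integral>\<^sup>+x. f x * indicator (A i) x \<partial>N)"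
      using fin by (intro N.product_nn_integral_prod) auto
    also have "\<dots> = (\<Prod>i\<in>I. emeasure (density N f) (A i))"
      by (intro prod.cong refl emeasure_density[symmetric]) auto
    finally show "emeasure (density (PiM I (\<lambda>_. N)) (\<lambda>x. \<Prod>i\<in>I. f (x i))) (Pi\<^sub>E I A) =
        (\<Prod>i\<in>I. emeasure (density N f) (A i))" .
  qed
qed

text \<open>
  The distribution of an independent sequence with density \<open>f\<close> is the measure called \<open>S\<close> in
  \<open>sequence_space\<close>.
\<close>

locale real_density =
  fixes f :: "real \<Rightarrow> real"
  assumes nonneg: "\<And>x. 0 \<le> f x" and total: "has_bochner_integral lborel f 1"
begin

definition law :: "real measure" where
  "law = density lborel (\<lambda>x. ennreal (f x))"

lemma f_measurable [measurable]: "f \<in> borel_measurable borel"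
  using total borel_measurable_integrable[of lborel f] by (simp add: has_bochner_integral_iff)

lemma prob_space_law: "prob_space law"
proof
  have "emeasure law (space law) = (\<integral>\<^sup>+x. ennreal (f x) \<partial>lborel)"
    by (simp add: law_def emeasure_density)
  also have "\<dots> = ennreal (integral\<^sup>L lborel f)"
    using total nonneg by (intro nn_integral_eq_integral) (auto simp: has_bochner_integral_iff)
  finally show "emeasure law (space law) = 1"
    using total by (simp add: has_bochner_integral_integral_eq)
qed

sublocale law: prob_space law by (rule prob_space_law)

sublocale sequence_space law ..

lemma sets_law [measurable_cong]: "sets law = sets borel"
  by (simp add: law_def)

lemma space_law [simp]: "space law = UNIV"
  by (simp add: law_def)

lemma space_S [simp]: "space S = UNIV"
  by (simp add: space_PiM)

lemma seq_cone_sets [measurable]: "seq_cone u \<in> sets S"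
proof -
  have "Measurable.pred S (\<lambda>x. \<forall>k\<in>{1..max_letter u}. 0 \<le> partial_sum u x k)"
    unfolding partial_sum_def by measurable
  then show ?thesis by (simp add: seq_cone_def pred_def)
qed

text \<open>
  The density of the product measure turns the integral into a probability for \<open>length u\<close>
  coordinates, and adding further independent coordinates does not change it.
\<close>

lemma m_word_eq_prob:
  "m_word f u = (-1) ^ max_letter (letters u) * measure S (seq_cone (letters u))"
proof -
  let ?n = "length (letters u)" and ?I = "{..<length (letters u)}"
  let ?L = "PiM ?I (\<lambda>_. lborel :: real measure)" and ?P = "PiM ?I (\<lambda>_. law)"
  have dens: "?P = density ?L (\<lambda>x. ennreal (\<Prod>i<?n. f (x i)))"
    unfolding law_def
    using law.sigma_finite_measure_axioms
    by (subst PiM_density) (auto simp: law_def prod_ennreal nonneg sigma_finite_lborel)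
  have sets_eq: "sets ?P = sets ?L"
    by (intro sets_PiM_cong) (simp_all add: sets_law)
  have "Measurable.pred ?L (\<lambda>x. \<forall>k\<in>{1..max_letter (letters u)}. 0 \<le> partial_sum (letters u) x k)"
    unfolding partial_sum_def by measurable
  then have cone_L: "cone u \<in> sets ?L"
    by (simp add: cone_eq_seq_cone seq_cone_def pred_def space_PiM Int_def conj_commute)
  have "(LINT x:cone u|?L. \<Prod>i<?n. f (x i)) = (LINT x|?L. (\<Prod>i<?n. f (x i)) * indicator (cone u) x)"
    by (simp add: set_lebesgue_integral_def mult.commute)
  also have "\<dots> = (LINT x|?P. indicator (cone u) x)"
    unfolding dens using cone_L
    by (subst integral_density) (auto intro!: prod_nonneg nonneg borel_measurable_indicator)
  also have "\<dots> = measure ?P (cone u)"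
    using cone_L sets_eq by simp
  also have "\<dots> = measure (distr S ?P (\<lambda>\<omega>. \<lambda>n\<in>?I. \<omega> n)) (cone u)"
    using distr_PiM_reindex[of UNIV "\<lambda>_. law" id ?I] prob_space_law by simp
  also have "\<dots> = measure S ((\<lambda>\<omega>. \<lambda>n\<in>?I. \<omega> n) -` cone u \<inter> space S)"
    using cone_L sets_eq by (intro measure_distr measurable_restrict) auto
  also have "(\<lambda>\<omega>. \<lambda>n\<in>?I. \<omega> n) -` cone u \<inter> space S = seq_cone (letters u)"
  proof (rule set_eqI)
    fix \<omega> :: "nat \<Rightarrow> real"
    have "restrict \<omega> ?I \<in> seq_cone (letters u) \<longleftrightarrow> \<omega> \<in> seq_cone (letters u)"
      by (rule seq_cone_cong) simp
    then show "\<omega> \<in> (\<lambda>\<omega>. \<lambda>n\<in>?I. \<omega> n) -` cone u \<inter> space S \<longleftrightarrow> \<omega> \<in> seq_cone (letters u)"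
      by (simp add: cone_eq_seq_cone)
  qed
  finally show ?thesis by (simp add: m_word_def)
qed

text \<open>
  Independent and identically distributed coordinates selected without repetition have the same
  joint distribution as the original ones.
\<close>

lemma prob_reindex:
  assumes "inj p" and [measurable]: "A \<in> sets S"
  shows "measure S {x. x \<circ> p \<in> A} = measure S A"
proof -
  have "measure S A = measure (distr S S (\<lambda>x. x \<circ> p)) A"
    using distr_PiM_reindex[of UNIV "\<lambda>_. law" p UNIV] prob_space_law assms(1)
    by (simp add: comp_def restrict_UNIV)
  also have "\<dots> = measure S ((\<lambda>x. x \<circ> p) -` A \<inter> space S)"
    by (intro measure_distr) (auto simp: comp_def intro!: measurable_PiM_single')
  finally show ?thesis by (simp add: vimage_def)
qed

text \<open>
  A permutation of positions that carries the blocks of one word to those of the other carries one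
  cone to the other.
\<close>

lemma prob_seq_cone_permute:
  assumes "mset u = mset v"
  shows "measure S (seq_cone u) = measure S (seq_cone v)"
proof -
  obtain p where p: "p permutes {..<length v}" and u: "permute_list p v = u"
    using mset_eq_permutation[OF assms] .
  have len: "length u = length v" using u by auto
  have "max_letter u = max_letter v"
    using assms by (metis max_letter_def set_mset_mset)
  moreover have "partial_sum u (x \<circ> p) k = partial_sum v x k" for x k
    unfolding partial_sum_def
  proof (rule sum.reindex_bij_witness[where i = "inv p" and j = p])
  qed (use p in \<open>auto simp: len u[symmetric] permute_list_nth permutes_inverses
         permutes_in_image[of p "{..<length v}", simplified lessThan_iff]
         permutes_in_image[OF permutes_inv, of p "{..<length v}", simplified lessThan_iff]\<close>)
  ultimately have "{x. x \<circ> p \<in> seq_cone u} = seq_cone v"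
    by (simp add: seq_cone_def)
  then show ?thesis
    using prob_reindex[OF permutes_inj[OF p], of "seq_cone u"] by simp
qed

text \<open>
  An event determined by the first \<open>n\<close> coordinates is independent of every event determined by the
  later ones: an independent sequence is the concatenation of its first \<open>n\<close> terms with an
  independent copy of the sequence.
\<close>

lemma prob_independent:
  assumes [measurable]: "A \<in> sets S" "B \<in> sets S"
    and A: "\<And>x y. (\<And>i. i < n \<Longrightarrow> x i = y i) \<Longrightarrow> x \<in> A \<longleftrightarrow> y \<in> A"
  shows "measure S {x. x \<in> A \<and> (\<lambda>i. x (n + i)) \<in> B} = measure S A * measure S B"
proof -
  let ?E = "{x. x \<in> A \<and> (\<lambda>i. x (n + i)) \<in> B}"
  have [measurable]: "(\<lambda>x i. x (n + i)) \<in> measurable S S"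
    by (auto intro!: measurable_PiM_single')
  have E: "?E \<in> sets S"
  proof -
    have "Measurable.pred S (\<lambda>x. x \<in> A \<and> (\<lambda>i. x (n + i)) \<in> B)" by measurable
    then show ?thesis by (simp add: pred_def)
  qed
  have "measure S ?E = measure (distr (S \<Otimes>\<^sub>M S) S (\<lambda>(x, y). comb_seq n x y)) ?E"
    by (simp add: PiM_comb_seq)
  also have "\<dots> = measure (S \<Otimes>\<^sub>M S) ((\<lambda>(x, y). comb_seq n x y) -` ?E \<inter> space (S \<Otimes>\<^sub>M S))"
    using E by (intro measure_distr measurable_comb_seq) 
  also have "(\<lambda>(x, y). comb_seq n x y) -` ?E \<inter> space (S \<Otimes>\<^sub>M S) = A \<times> B"
    using A[of "comb_seq n _ _"] by (auto simp: space_pair_measure comb_seq_def)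
  also have "measure (S \<Otimes>\<^sub>M S) (A \<times> B) = measure S A * measure S B"
    by (simp add: measure_def emeasure_pair_measure_Times enn2real_mult)
  finally show ?thesis .
qed

end

section \<open>Words occurring in a product of basis elements\<close>

lemma max_letter_packed: "set u = {1..k} \<Longrightarrow> max_letter u = k"
  unfolding max_letter_def by (rule Max_eqI) (cases k; auto)+

lemma packed_iff: "packed u \<longleftrightarrow> (\<exists>k. set u = {1..k})"
  using max_letter_packed[of u] by (auto simp: packed_def)

definition rank_in :: "nat set \<Rightarrow> nat \<Rightarrow> nat" where
  "rank_in A k = card (A \<inter> {..k})"

lemma pack_eq_rank: "pack w = map (rank_in (set w)) w"
  by (auto simp: pack_def rank_in_def intro!: arg_cong[of _ _ card])

lemma rank_mono: "finite A \<Longrightarrow> i \<le> k \<Longrightarrow> rank_in A i \<le> rank_in A k"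
  unfolding rank_in_def by (intro card_mono) auto

lemma rank_le_iff:
  assumes "finite A" "i \<in> A"
  shows "rank_in A i \<le> rank_in A k \<longleftrightarrow> i \<le> k"
proof
  assume le: "rank_in A i \<le> rank_in A k"
  show "i \<le> k"
  proof (rule ccontr)
    assume "\<not> i \<le> k"
    then have "A \<inter> {..k} \<subset> A \<inter> {..i}" using assms by auto
    then have "rank_in A k < rank_in A i" unfolding rank_in_def using assms by (intro psubset_card_mono) auto
    with le show False by simp
  qed
qed (simp add: rank_mono assms)

lemma inj_on_rank: "finite A \<Longrightarrow> inj_on (rank_in A) A"
  by (rule inj_onI) (metis rank_le_iff order_antisym order_refl)

lemma rank_image:
  assumes "finite A"
  shows "rank_in A ` A = {1..card A}"
proof (rule card_subset_eq)
  show "rank_in A ` A \<subseteq> {1..card A}"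
  proof clarsimp
    fix k assume "k \<in> A"
    then have "card {k} \<le> rank_in A k" "rank_in A k \<le> card A"
      unfolding rank_in_def using assms by (auto intro!: card_mono simp del: card.insert card_0_eq)
    then show "Suc 0 \<le> rank_in A k \<and> rank_in A k \<le> card A" by simp
  qed
qed (simp_all add: card_image inj_on_rank assms)

lemma set_pack: "set (pack (w :: nat list)) = {1..card (set w)}"
  by (simp add: pack_eq_rank rank_image)

text \<open>
  Inverse to packing: \<open>place A u\<close> is the word with letter set \<open>A\<close> whose packing is \<open>u\<close>.
\<close>

definition place :: "nat set \<Rightarrow> nat list \<Rightarrow> nat list" where
  "place A u = map (inv_into A (rank_in A)) u"

lemma length_place [simp]: "length (place A u) = length u"
  by (simp add: place_def)

lemma place_pack: "place (set w) (pack w) = w"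
  by (simp add: place_def pack_eq_rank inj_on_rank map_idI)

lemma
  assumes "finite A" "set u = {1..card A}"
  shows set_place: "set (place A u) = A" and pack_place: "pack (place A u) = u"
proof -
  have eq: "rank_in A ` A = set u" using assms rank_image by simp
  show *: "set (place A u) = A"
    unfolding place_def set_map eq[symmetric] using inj_on_rank[OF assms(1)] by simp
  show "pack (place A u) = u"
    unfolding pack_eq_rank * by (simp add: place_def eq f_inv_into_f map_idI)
qed

text \<open>
  The pairs of letter sets of \<open>w'\<close> and \<open>w''\<close>, for \<open>w = w'w''\<close> packed with \<open>r\<close> distinct letters in
  \<open>w'\<close> and \<open>s\<close> in \<open>w''\<close>.  Deciding for \<open>k = 1, 2, \<dots>\<close> whether \<open>k\<close> lies in \<open>A\<close>, in \<open>B\<close> or in both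
  gives a Delannoy path from \<open>(0, 0)\<close> to \<open>(r, s)\<close>, and any such path arises.
\<close>

definition overlaps :: "nat \<Rightarrow> nat \<Rightarrow> (nat set \<times> nat set) set" where
  "overlaps r s = {(A, B). A \<union> B = {1..card (A \<union> B)} \<and> card A = r \<and> card B = s}"

lemma overlapsD:
  assumes "(A, B) \<in> overlaps r s"
  shows "finite A" "finite B" "card A = r" "card B = s" "A \<union> B = {1..card (A \<union> B)}"
proof -
  show *: "A \<union> B = {1..card (A \<union> B)}" and "card A = r" "card B = s"
    using assms by (auto simp: overlaps_def)
  have "finite (A \<union> B)" by (subst *) simp
  then show "finite A" "finite B" by auto
qed

lemma overlapsI: "A \<union> B = {1..t} \<Longrightarrow> card A = r \<Longrightarrow> card B = s \<Longrightarrow> (A, B) \<in> overlaps r s"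
  by (auto simp: overlaps_def)

lemma finite_overlaps: "finite (overlaps r s)"
proof (rule finite_subset)
  show "overlaps r s \<subseteq> Pow {1..r + s} \<times> Pow {1..r + s}"
  proof clarify
    fix A B assume AB: "(A, B) \<in> overlaps r s"
    have "card (A \<union> B) \<le> r + s"
      using card_Un_le[of A B] overlapsD[OF AB] by simp
    then have "A \<union> B \<subseteq> {1..r + s}" by (subst overlapsD(5)[OF AB]) simp
    then show "A \<in> Pow {1..r + s} \<and> B \<in> Pow {1..r + s}" by auto
  qed
qed simp

text \<open>
  One more step of the path: the new largest letter is added to \<open>A\<close> if \<open>P\<close>, and to \<open>B\<close> if \<open>Q\<close>.
\<close>

definition extend :: "bool \<Rightarrow> bool \<Rightarrow> nat set \<times> nat set \<Rightarrow> nat set \<times> nat set" where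
  "extend P Q = (\<lambda>(A, B). let t = Suc (card (A \<union> B)) in
     (if P then insert t A else A, if Q then insert t B else B))"

lemma extend_overlaps:
  assumes AB: "(A, B) \<in> overlaps r s" and PQ: "P \<or> Q" and e: "extend P Q (A, B) = (A', B')"
  defines "t \<equiv> card (A \<union> B)"
  shows "(A', B') \<in> overlaps (r + of_bool P) (s + of_bool Q)"
    and "card (A' \<union> B') = Suc t" and "Suc t \<in> A' \<longleftrightarrow> P" and "Suc t \<in> B' \<longleftrightarrow> Q"
    and "A = A' - {Suc t}" and "B = B' - {Suc t}"
    and "\<And>k. k \<le> t \<Longrightarrow> rank_in A' k = rank_in A k" and "\<And>k. k \<le> t \<Longrightarrow> rank_in B' k = rank_in B k"
    and "rank_in A' (Suc t) = r + of_bool P" and "rank_in B' (Suc t) = s + of_bool Q"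
proof -
  note D = overlapsD[OF AB]
  have un: "A \<union> B = {1..t}" using D(5) by (simp add: t_def)
  have "Suc t \<notin> A \<union> B" by (simp add: un)
  then have new: "Suc t \<notin> A" "Suc t \<notin> B" by auto
  have A': "A' = (if P then insert (Suc t) A else A)" and B': "B' = (if Q then insert (Suc t) B else B)"
    using e by (auto simp: extend_def t_def Let_def)
  have "A' \<union> B' = insert (Suc t) (A \<union> B)" using PQ by (auto simp: A' B')
  also have "\<dots> = {1..Suc t}" unfolding un by auto
  finally have un': "A' \<union> B' = {1..Suc t}" .
  have card: "card A' = r + of_bool P" "card B' = s + of_bool Q"
    using D new by (auto simp: A' B')
  show "(A', B') \<in> overlaps (r + of_bool P) (s + of_bool Q)"
    using un' card by (rule overlapsI)
  show "card (A' \<union> B') = Suc t" by (simp add: un')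
  show "Suc t \<in> A' \<longleftrightarrow> P" "Suc t \<in> B' \<longleftrightarrow> Q" "A = A' - {Suc t}" "B = B' - {Suc t}"
    using new by (auto simp: A' B')
  show "rank_in A' k = rank_in A k" "rank_in B' k = rank_in B k" if "k \<le> t" for k
    using that by (auto simp: A' B' rank_in_def)
  have "A' \<inter> {..Suc t} = A'" "B' \<inter> {..Suc t} = B'" using un' by auto
  then show "rank_in A' (Suc t) = r + of_bool P" "rank_in B' (Suc t) = s + of_bool Q"
    using card by (simp_all add: rank_in_def)
qed

text \<open>
  A nonempty path is the extension of the path obtained by deleting the largest letter.
\<close>

lemma overlaps_cases:
  assumes AB: "(A, B) \<in> overlaps r s" and pos: "r \<noteq> 0 \<or> s \<noteq> 0"
  obtains P Q r' s' A' B' where "P \<or> Q" "r = r' + of_bool P" "s = s' + of_bool Q"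
    "(A', B') \<in> overlaps r' s'" "(A, B) = extend P Q (A', B')"
proof -
  note D = overlapsD[OF AB]
  have "card (A \<union> B) \<noteq> 0" using D pos by auto
  then obtain t where t: "card (A \<union> B) = Suc t" by (cases "card (A \<union> B)") auto
  have un: "A \<union> B = {1..Suc t}" using D(5) t by simp
  let ?A = "A - {Suc t}" and ?B = "B - {Suc t}"
  have "?A \<union> ?B = A \<union> B - {Suc t}" by auto
  also have "\<dots> = {1..t}" unfolding un by auto
  finally have un': "?A \<union> ?B = {1..t}" .
  show thesis
  proof (rule that)
    have "Suc t \<in> A \<union> B" by (simp add: un)
    then show "Suc t \<in> A \<or> Suc t \<in> B" by simp
    show "r = card ?A + of_bool (Suc t \<in> A)"
      using D card_Suc_Diff1[of A "Suc t"] by auto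
    show "s = card ?B + of_bool (Suc t \<in> B)"
      using D card_Suc_Diff1[of B "Suc t"] by auto
    show "(?A, ?B) \<in> overlaps (card ?A) (card ?B)"
      using un' by (rule overlapsI) auto
    show "(A, B) = extend (Suc t \<in> A) (Suc t \<in> B) (?A, ?B)"
      by (simp add: extend_def un' insert_absorb Let_def)
  qed
qed

lemma extend_eqD:
  assumes X: "X \<in> overlaps r s" and Y: "Y \<in> overlaps r' s'" and PQ: "P \<or> Q" "P' \<or> Q'"
    and eq: "extend P Q X = extend P' Q' Y"
  shows "P = P' \<and> Q = Q' \<and> X = Y"
proof -
  obtain A B A' B' C E where XY: "X = (A, B)" "Y = (A', B')" "extend P Q X = (C, E)"
    by (metis surj_pair)
  have X': "(A, B) \<in> overlaps r s" "extend P Q (A, B) = (C, E)"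
    and Y': "(A', B') \<in> overlaps r' s'" "extend P' Q' (A', B') = (C, E)"
    using X Y XY eq by auto
  note x = extend_overlaps(2-6)[OF X'(1) PQ(1) X'(2)] and y = extend_overlaps(2-6)[OF Y'(1) PQ(2) Y'(2)]
  have "card (A \<union> B) = card (A' \<union> B')" using x(1) y(1) by simp
  then show ?thesis using x(2-5) y(2-5) XY by auto
qed

text \<open>
  Extension is injective, so a factor that each extension contributes comes out of the sum.
\<close>

lemma sum_overlaps_extend:
  assumes "P \<or> Q" and "\<And>A B. (A, B) \<in> overlaps r s \<Longrightarrow> g (extend P Q (A, B)) = c * g (A, B)"
  shows "sum g (extend P Q ` overlaps r s) = c * (sum g (overlaps r s) :: real)"
proof -
  have "inj_on (extend P Q) (overlaps r s)"
    using extend_eqD[OF _ _ assms(1) assms(1)] by (meson inj_onI)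
  then show ?thesis
    unfolding sum_distrib_left using assms(2) by (subst sum.reindex) (auto intro!: sum.cong)
qed

lemma overlaps_0_0: "overlaps 0 0 = {({}, {})}"
proof -
  have "A = {} \<and> B = {}" if "(A, B) \<in> overlaps 0 0" for A B
    using overlapsD[OF that] by simp
  moreover have "({}, {}) \<in> overlaps 0 0" by (rule overlapsI[of _ _ 0]) auto
  ultimately show ?thesis by auto
qed

lemma extend_image_subset:
  assumes "P \<or> Q"
  shows "extend P Q ` overlaps r s \<subseteq> overlaps (r + of_bool P) (s + of_bool Q)"
proof clarify
  fix A B A' B' assume "(A, B) \<in> overlaps r s" "(A', B') = extend P Q (A, B)"
  then show "(A', B') \<in> overlaps (r + of_bool P) (s + of_bool Q)"
    using extend_overlaps(1)[OF _ assms] by metis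
qed

lemma overlaps_Suc_0: "overlaps (Suc r) 0 = extend True False ` overlaps r 0"
proof
  show "overlaps (Suc r) 0 \<subseteq> extend True False ` overlaps r 0"
  proof clarify
    fix A B assume "(A, B) \<in> overlaps (Suc r) 0"
    then show "(A, B) \<in> extend True False ` overlaps r 0"
      by (rule overlaps_cases) (auto split: if_splits)
  qed
qed (use extend_image_subset[of True False r 0] in simp)

lemma overlaps_0_Suc: "overlaps 0 (Suc s) = extend False True ` overlaps 0 s"
proof
  show "overlaps 0 (Suc s) \<subseteq> extend False True ` overlaps 0 s"
  proof clarify
    fix A B assume "(A, B) \<in> overlaps 0 (Suc s)"
    then show "(A, B) \<in> extend False True ` overlaps 0 s"
      by (rule overlaps_cases) (auto split: if_splits)
  qed
qed (use extend_image_subset[of False True 0 s] in simp)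

lemma overlaps_Suc_Suc:
  "overlaps (Suc r) (Suc s) = extend True False ` overlaps r (Suc s)
     \<union> extend False True ` overlaps (Suc r) s \<union> extend True True ` overlaps r s"
proof
  show "overlaps (Suc r) (Suc s) \<subseteq> extend True False ` overlaps r (Suc s)
     \<union> extend False True ` overlaps (Suc r) s \<union> extend True True ` overlaps r s"
  proof
    fix X assume X: "X \<in> overlaps (Suc r) (Suc s)"
    obtain A B where "X = (A, B)" by force
    then obtain P Q r' s' Y where "P \<or> Q" "Suc r = r' + of_bool P" "Suc s = s' + of_bool Q"
        "Y \<in> overlaps r' s'" "X = extend P Q Y"
      using X by (metis overlaps_cases nat.distinct(1))
    then show "X \<in> extend True False ` overlaps r (Suc s)
        \<union> extend False True ` overlaps (Suc r) s \<union> extend True True ` overlaps r s"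
      by (cases P; cases Q) simp_all
  qed
qed (use extend_image_subset[of True False r "Suc s"] extend_image_subset[of False True "Suc r" s]
       extend_image_subset[of True True r s] in simp)

text \<open>
  The signed indicator of the cone of \<open>w\<close> as a function of the path: \<open>a i\<close> and \<open>b j\<close> stand for
  the partial sums over the first \<open>i\<close> blocks of \<open>w'\<close> and the first \<open>j\<close> blocks of \<open>w''\<close>, and the
  path visits \<open>(rank_in A k, rank_in B k)\<close> after \<open>k\<close> steps.
\<close>

definition signed_pos :: "(nat \<Rightarrow> real) \<Rightarrow> (nat \<Rightarrow> real) \<Rightarrow> nat set \<times> nat set \<Rightarrow> real" where
  "signed_pos a b = (\<lambda>(A, B). (-1) ^ card (A \<union> B) *
     of_bool (\<forall>k\<in>{1..card (A \<union> B)}. 0 \<le> a (rank_in A k) + b (rank_in B k)))"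

lemma signed_pos_extend:
  assumes AB: "(A, B) \<in> overlaps r s" and PQ: "P \<or> Q"
  shows "signed_pos a b (extend P Q (A, B)) =
    - of_bool (0 \<le> a (r + of_bool P) + b (s + of_bool Q)) * signed_pos a b (A, B)"
proof -
  obtain A' B' where e: "extend P Q (A, B) = (A', B')" by force
  note E = extend_overlaps[OF AB PQ e]
  let ?t = "card (A \<union> B)"
  have "(\<forall>k\<in>{1..Suc ?t}. 0 \<le> a (rank_in A' k) + b (rank_in B' k)) \<longleftrightarrow>
      0 \<le> a (rank_in A' (Suc ?t)) + b (rank_in B' (Suc ?t)) \<and>
      (\<forall>k\<in>{1..?t}. 0 \<le> a (rank_in A' k) + b (rank_in B' k))"
    by (auto simp: le_Suc_eq)
  also have "\<dots> \<longleftrightarrow> 0 \<le> a (r + of_bool P) + b (s + of_bool Q) \<and>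
      (\<forall>k\<in>{1..?t}. 0 \<le> a (rank_in A k) + b (rank_in B k))"
    using E(7-10) by auto
  finally show ?thesis
    by (simp add: e signed_pos_def E(2) of_bool_conj)
qed

text \<open>
  By induction on the length of the paths.  Classified by the last step, the paths to \<open>(r, s)\<close>
  extend those to \<open>(r - 1, s)\<close>, \<open>(r, s - 1)\<close> and \<open>(r - 1, s - 1)\<close>, and each extension contributes the
  factor \<open>- [a r + b s \<ge> 0]\<close>.  By the induction hypothesis the three sums have a common factor, and
  what remains is \<open>[a r + b s \<ge> 0] ([a r \<ge> 0] + [b s \<ge> 0] - 1) = [a r \<ge> 0] [b s \<ge> 0]\<close>.  If \<open>r\<close> or
  \<open>s\<close> is \<open>0\<close>, there is only one kind of step, and \<open>a 0 = b 0 = 0\<close> closes the recursion.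
\<close>

lemma sum_signed_pos:
  assumes a: "a 0 = 0" and b: "b 0 = 0"
  shows "(\<Sum>X\<in>overlaps r s. signed_pos a b X) =
    (-1) ^ (r + s) * of_bool ((\<forall>i\<in>{1..r}. 0 \<le> a i) \<and> (\<forall>j\<in>{1..s}. 0 \<le> b j))"
    (is "?T r s = ?R r s")
proof -
  have step: "(\<Sum>X\<in>extend P Q ` overlaps r s. signed_pos a b X) =
      - of_bool (0 \<le> a (r + of_bool P) + b (s + of_bool Q)) * ?T r s" if "P \<or> Q" for P Q r s
    by (rule sum_overlaps_extend[OF that signed_pos_extend[OF _ that]])
  have R_Suc: "(\<forall>i\<in>{1..Suc r}. 0 \<le> c i) \<longleftrightarrow> (\<forall>i\<in>{1..r}. 0 \<le> c i) \<and> 0 \<le> c (Suc r)"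
    for c :: "nat \<Rightarrow> real" and r
    by (auto simp: le_Suc_eq)
  show ?thesis
  proof (induction "r + s" arbitrary: r s rule: less_induct)
    case less
    consider "r = 0" "s = 0" | r' where "r = Suc r'" "s = 0" | s' where "r = 0" "s = Suc s'"
      | r' s' where "r = Suc r'" "s = Suc s'"
      by (cases r; cases s) auto
    then show ?case
    proof cases
      case 1
      then show ?thesis by (simp add: overlaps_0_0 signed_pos_def)
    next
      case (2 r')
      then have "?T r s = - of_bool (0 \<le> a (Suc r')) * ?T r' 0"
        using step[of True False r' 0] by (simp add: overlaps_Suc_0 b)
      also have "?T r' 0 = ?R r' 0" using less 2 by simp
      finally show ?thesis using 2 by (simp only: R_Suc) (auto simp: of_bool_def)
    next
      case (3 s')
      then have "?T r s = - of_bool (0 \<le> b (Suc s')) * ?T 0 s'"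
        using step[of False True 0 s'] by (simp add: overlaps_0_Suc a)
      also have "?T 0 s' = ?R 0 s'" using less 3 by simp
      finally show ?thesis using 3 by (simp only: R_Suc) (auto simp: of_bool_def)
    next
      case (4 r' s')
      have disj: "extend P Q ` overlaps i j \<inter> extend P' Q' ` overlaps i' j' = {}"
        if "P \<or> Q" "P' \<or> Q'" "(P, Q) \<noteq> (P', Q')" for P Q P' Q' i j i' j'
        using extend_eqD[OF _ _ that(1,2)] that(3) by blast
      have "?T r s = (\<Sum>X\<in>extend True False ` overlaps r' (Suc s'). signed_pos a b X)
          + (\<Sum>X\<in>extend False True ` overlaps (Suc r') s'. signed_pos a b X)
          + (\<Sum>X\<in>extend True True ` overlaps r' s'. signed_pos a b X)"
        unfolding 4 overlaps_Suc_Suc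
        by (subst sum.union_disjoint sum.union_disjoint;
            simp add: finite_overlaps disj Int_Un_distrib2)+
      also have "\<dots> = - of_bool (0 \<le> a (Suc r') + b (Suc s')) *
          (?T r' (Suc s') + ?T (Suc r') s' + ?T r' s')"
        by (simp add: step algebra_simps)
      also have "?T r' (Suc s') + ?T (Suc r') s' + ?T r' s' =
          ?R r' (Suc s') + ?R (Suc r') s' + ?R r' s'"
        using less 4 by simp
      finally show ?thesis unfolding 4 R_Suc by (auto simp: of_bool_def)
    qed
  qed
qed

text \<open>
  The word \<open>w = w'w''\<close> with given packings of \<open>w'\<close> and \<open>w''\<close> and given letter sets.
\<close>

definition overlay :: "packed_word \<Rightarrow> packed_word \<Rightarrow> nat set \<times> nat set \<Rightarrow> packed_word" where
  "overlay u v = (\<lambda>(A, B). Packed_word (place A (letters u) @ place B (letters v)))"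

lemma overlay_overlaps:
  assumes AB: "(A, B) \<in> overlaps (max_letter (letters u)) (max_letter (letters v))"
  shows "letters (overlay u v (A, B)) = place A (letters u) @ place B (letters v)"
    and "set (place A (letters u)) = A" and "set (place B (letters v)) = B"
    and "pack (place A (letters u)) = letters u" and "pack (place B (letters v)) = letters v"
    and "max_letter (letters (overlay u v (A, B))) = card (A \<union> B)"
proof -
  note D = overlapsD[OF AB]
  show A: "set (place A (letters u)) = A" and "pack (place A (letters u)) = letters u"
    using D set_letters[of u] by (auto intro!: set_place pack_place)
  show B: "set (place B (letters v)) = B" and "pack (place B (letters v)) = letters v"
    using D set_letters[of v] by (auto intro!: set_place pack_place)
  have s: "set (place A (letters u) @ place B (letters v)) = {1..card (A \<union> B)}"
    using D(5) by (simp add: A B)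
  then show l: "letters (overlay u v (A, B)) = place A (letters u) @ place B (letters v)"
    unfolding overlay_def using packed_iff by (auto intro!: Packed_word_inverse)
  show "max_letter (letters (overlay u v (A, B))) = card (A \<union> B)"
    using s unfolding l by (rule max_letter_packed)
qed

lemma struct_nz_iff: "wqsym_struct u v w \<noteq> 0 \<longleftrightarrow>
  pack (take (length (letters u)) (letters w)) = letters u \<and>
  pack (drop (length (letters u)) (letters w)) = letters v"
proof
  assume "wqsym_struct u v w \<noteq> 0"
  then obtain w' w'' where w: "letters w = w' @ w''" "pack w' = letters u" "pack w'' = letters v"
    by (auto simp: wqsym_struct_def split: if_splits)
  moreover from w have "length (letters u) = length w'" by (metis length_pack)
  ultimately show "pack (take (length (letters u)) (letters w)) = letters u \<and>
    pack (drop (length (letters u)) (letters w)) = letters v" by simp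
qed (auto simp: wqsym_struct_def intro: append_take_drop_id[symmetric])

lemma bij_betw_overlay:
  "bij_betw (overlay u v) (overlaps (max_letter (letters u)) (max_letter (letters v)))
     {w. wqsym_struct u v w \<noteq> 0}"
proof (rule bij_betw_byWitness[where f' = "\<lambda>w. (set (take (length (letters u)) (letters w)),
    set (drop (length (letters u)) (letters w)))"])
  let ?D = "overlaps (max_letter (letters u)) (max_letter (letters v))"
  let ?n = "length (letters u)"
  let ?f' = "\<lambda>w. (set (take ?n (letters w)), set (drop ?n (letters w)))"
  show "\<forall>X\<in>?D. ?f' (overlay u v X) = X"
    by (auto simp: overlay_overlaps)
  show "overlay u v ` ?D \<subseteq> {w. wqsym_struct u v w \<noteq> 0}"
    by (auto simp: struct_nz_iff overlay_overlaps)
  have *: "?f' w \<in> ?D \<and> overlay u v (?f' w) = w" if "wqsym_struct u v w \<noteq> 0" for w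
  proof
    let ?w' = "take ?n (letters w)" and ?w'' = "drop ?n (letters w)"
    have p: "pack ?w' = letters u" "pack ?w'' = letters v"
      using that by (auto simp: struct_nz_iff)
    have "set ?w' \<union> set ?w'' = {1..max_letter (letters w)}"
      using set_letters[of w] by (metis append_take_drop_id set_append)
    moreover have "card (set ?w') = max_letter (letters u)" "card (set ?w'') = max_letter (letters v)"
      using max_letter_packed[OF set_pack] p by metis+
    ultimately show D: "?f' w \<in> ?D" by (rule overlapsI)
    have "letters (overlay u v (?f' w)) = letters w"
      unfolding overlay_overlaps(1)[OF D] using p place_pack[of ?w'] place_pack[of ?w''] by simp
    then show "overlay u v (?f' w) = w" by (simp add: letters_inject)
  qed
  then show "\<forall>w\<in>{w. wqsym_struct u v w \<noteq> 0}. overlay u v (?f' w) = w"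
    and "?f' ` {w. wqsym_struct u v w \<noteq> 0} \<subseteq> ?D" by auto
qed

lemma partial_sum_append:
  "partial_sum (u @ v) x k = partial_sum u x k + partial_sum v (\<lambda>i. x (length u + i)) k"
proof -
  have *: "{i. i < length (u @ v) \<and> (u @ v) ! i \<le> k} =
      {i. i < length u \<and> u ! i \<le> k} \<union> (+) (length u) ` {i. i < length v \<and> v ! i \<le> k}"
    (is "?L = ?R")
  proof (rule set_eqI)
    fix i show "i \<in> ?L \<longleftrightarrow> i \<in> ?R"
      by (cases "i < length u") (auto simp: nth_append not_less le_iff_add)
  qed
  have "sum x ?L = sum x {i. i < length u \<and> u ! i \<le> k}
      + sum x ((+) (length u) ` {i. i < length v \<and> v ! i \<le> k})"
    unfolding * by (rule sum.union_disjoint) auto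
  also have "sum x ((+) (length u) ` {i. i < length v \<and> v ! i \<le> k}) =
      (\<Sum>i | i < length v \<and> v ! i \<le> k. x (length u + i))"
    by (rule sum.reindex_cong[of "(+) (length u)"]) auto
  finally show ?thesis unfolding partial_sum_def .
qed

text \<open>
  A letter of \<open>w\<close> is at most \<open>k\<close> exactly when its rank is at most the number of letters of \<open>w\<close> up to
  \<open>k\<close>; this is how the inequalities of the cone of \<open>w'w''\<close> become sums of those for its packed parts.
\<close>

lemma partial_sum_pack: "partial_sum w x k = partial_sum (pack w) x (rank_in (set w) k)"
proof -
  have "rank_in (set w) (w ! i) \<le> rank_in (set w) k \<longleftrightarrow> w ! i \<le> k" if "i < length w" for i
    using that by (intro rank_le_iff) auto
  then have "{i. i < length w \<and> w ! i \<le> k} =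
      {i. i < length (pack w) \<and> pack w ! i \<le> rank_in (set w) k}"
    unfolding pack_eq_rank by auto
  then show ?thesis by (simp only: partial_sum_def)
qed

lemma partial_sum_0: "partial_sum (letters u) x 0 = 0"
  unfolding partial_sum_def using letters_nth_ge_1[of _ u] by (intro sum.neutral) fastforce

text \<open>
  The multiplication rule of \<open>WQSym\<close> for signed indicators of cones, valid at every point \<open>x\<close>: it is
  \<open>sum_signed_pos\<close> read through the bijection between paths and words.
\<close>

lemma sum_seq_cone:
  "(\<Sum>w | wqsym_struct u v w \<noteq> 0.
      (-1) ^ max_letter (letters w) * of_bool (x \<in> seq_cone (letters w))) =
   (-1) ^ (max_letter (letters u) + max_letter (letters v)) *
     (of_bool (x \<in> seq_cone (letters u) \<and>
       (\<lambda>i. x (length (letters u) + i)) \<in> seq_cone (letters v)) :: real)"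
proof -
  let ?y = "\<lambda>i. x (length (letters u) + i)"
  let ?a = "partial_sum (letters u) x" and ?b = "partial_sum (letters v) ?y"
  let ?D = "overlaps (max_letter (letters u)) (max_letter (letters v))"
  have "(-1) ^ max_letter (letters (overlay u v X)) * of_bool (x \<in> seq_cone (letters (overlay u v X)))
      = signed_pos ?a ?b X" if "X \<in> ?D" for X
  proof -
    obtain A B where X: "X = (A, B)" by force
    note O = overlay_overlaps[OF that[unfolded X]]
    have "partial_sum (letters (overlay u v (A, B))) x k = ?a (rank_in A k) + ?b (rank_in B k)" for k
      unfolding O(1) partial_sum_append length_place
      by (subst (1 2) partial_sum_pack) (simp only: O(2-5))
    then show ?thesis by (simp add: X signed_pos_def seq_cone_def O(6))
  qed
  then have "(\<Sum>w | wqsym_struct u v w \<noteq> 0.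
      (-1) ^ max_letter (letters w) * of_bool (x \<in> seq_cone (letters w))) =
      (\<Sum>X\<in>?D. signed_pos ?a ?b X)"
    unfolding sum.reindex_bij_betw[OF bij_betw_overlay, symmetric] by (intro sum.cong) auto
  then show ?thesis by (simp add: sum_signed_pos partial_sum_0 seq_cone_def)
qed

context real_density
begin

lemma m_word_mult:
  "(\<Sum>w | wqsym_struct u v w \<noteq> 0. m_word f w) = m_word f u * m_word f v"
proof -
  let ?s = "\<lambda>w. (-1) ^ max_letter (letters w) :: real" and ?C = "\<lambda>w. seq_cone (letters w)"
  let ?E = "{x. x \<in> ?C u \<and> (\<lambda>i. x (length (letters u) + i)) \<in> ?C v}"
  have [measurable]: "(\<lambda>x i. x (n + i)) \<in> measurable S S" for n
    by (auto intro!: measurable_PiM_single')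
  have "Measurable.pred S (\<lambda>x. x \<in> ?C u \<and> (\<lambda>i. x (length (letters u) + i)) \<in> ?C v)"
    by measurable
  then have E: "?E \<in> sets S" by (simp add: pred_def)
  have "(\<Sum>w | wqsym_struct u v w \<noteq> 0. m_word f w) =
      (\<Sum>w | wqsym_struct u v w \<noteq> 0. (LINT x|S. ?s w * indicator (?C w) x))"
    by (simp add: m_word_eq_prob)
  also have "\<dots> = (LINT x|S. (\<Sum>w | wqsym_struct u v w \<noteq> 0. ?s w * indicator (?C w) x))"
    by (rule Bochner_Integration.integral_sum[symmetric])
       (auto intro!: integrable_mult_right integrable_real_indicator simp: less_top[symmetric])
  also have "\<dots> = (LINT x|S. ?s u * ?s v * indicator ?E x)"
  proof (rule Bochner_Integration.integral_cong[OF refl])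
    fix x
    show "(\<Sum>w | wqsym_struct u v w \<noteq> 0. ?s w * indicator (?C w) x) = ?s u * ?s v * indicator ?E x"
      using sum_seq_cone[of x u v] by (simp add: indicator_def power_add of_bool_def)
  qed
  also have "\<dots> = ?s u * ?s v * measure S ?E"
    using E by simp
  also have "measure S ?E = measure S (?C u) * measure S (?C v)"
    by (intro prob_independent seq_cone_sets seq_cone_cong)
  finally show ?thesis by (simp add: m_word_eq_prob)
qed

end

section \<open>Structure constants of the coproduct of the free algebra\<close>

lift_definition nonzero_parts :: "nat list \<Rightarrow> composition" is "filter (\<lambda>n. n \<noteq> 0)"
  by simp

lemma nonzero_parts_simps [simp]:
  "nonzero_parts [] = 0"
  "nonzero_parts (n # ns) = one_part n + nonzero_parts ns"
  by (transfer; simp)+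

lemma nonzero_parts_parts: "nonzero_parts (parts I) = I"
proof -
  have "n \<noteq> 0" if "n \<in> set (parts I)" for n using parts[of I] that by (metis mem_Collect_eq)
  then show ?thesis by (simp add: parts_inject[symmetric] nonzero_parts.rep_eq filter_True)
qed

text \<open>
  A list is recovered from its nonzero entries and the places of its zeros.
\<close>

lemma nonzero_parts_inject:
  assumes "length ks = length ls" "\<And>i. i < length ks \<Longrightarrow> ks ! i = 0 \<longleftrightarrow> ls ! i = 0"
    and "nonzero_parts ks = nonzero_parts ls"
  shows "ks = ls"
proof -
  have "filter (\<lambda>n. n \<noteq> 0) ks = filter (\<lambda>n. n \<noteq> 0) ls"
    using assms(3) by (metis nonzero_parts.rep_eq)
  with assms(1,2) show ?thesis
  proof (induction ks ls rule: list_induct2)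
    case (Cons k ks l ls)
    have "k = 0 \<longleftrightarrow> l = 0"
      using Cons.prems(1)[of 0] by simp
    moreover have "ks ! i = 0 \<longleftrightarrow> ls ! i = 0" if "i < length ks" for i
      using Cons.prems(1)[of "Suc i"] that by simp
    ultimately show ?case using Cons.IH Cons.prems(2) by (auto split: if_splits)
  qed simp
qed

text \<open>
  The ways to pick one term \<open>S\<^sub>k \<otimes> S\<^bsub>n - k\<^esub>\<close> of \<open>\<Delta> S\<^sub>n\<close> for each entry \<open>n\<close> of a list.
\<close>

definition below :: "nat list \<Rightarrow> nat list set" where
  "below xs = {ks. list_all2 (\<le>) ks xs}"

lemma below_Nil [simp]: "below [] = {[]}"
  by (simp add: below_def)

lemma below_Cons: "below (n # xs) = (\<lambda>(k, ks). k # ks) ` ({..n} \<times> below xs)"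
  by (auto simp: below_def list_all2_Cons2)

lemma finite_below: "finite (below xs)"
  by (induction xs) (simp_all add: below_Cons)

text \<open>
  The choices of terms whose product is \<open>S\<^sup>J \<otimes> S\<^sup>K\<close>.  The list \<open>xs\<close> may contain
  zeros: they contribute factors \<open>S\<^sub>0 = 1\<close>, and exponent lists of monomials have them.
\<close>

definition splittings :: "nat list \<Rightarrow> composition \<Rightarrow> composition \<Rightarrow> nat list set" where
  "splittings xs J K = {ks \<in> below xs. nonzero_parts ks = J \<and> nonzero_parts (map2 (-) xs ks) = K}"

text \<open>
  Expansion of the product of the sums \<open>\<Delta> S\<^sub>n\<close>.  A factor \<open>S\<^sub>0\<close> is the unit, whence the zeros disappear
  from the indices.
\<close>

lemma prod_list_sym_coprod_gen:
  "prod_list (map sym_coprod_gen xs) =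
    (\<Sum>ks\<in>below xs. Poly_Mapping.single (nonzero_parts ks, nonzero_parts (map2 (-) xs ks)) 1)"
proof (induction xs)
  case Nil
  then show ?case by (simp flip: zero_prod_def)
next
  case (Cons n xs)
  have inj: "inj_on (\<lambda>(k, ks). k # ks) ({..n} \<times> below xs)"
    by (auto simp: inj_on_def)
  have "prod_list (map sym_coprod_gen (n # xs)) =
      (\<Sum>k\<le>n. Poly_Mapping.single (one_part k, one_part (n - k)) 1) *
      (\<Sum>ks\<in>below xs. Poly_Mapping.single (nonzero_parts ks, nonzero_parts (map2 (-) xs ks)) 1)"
    by (simp only: list.map prod_list.Cons Cons.IH sym_coprod_gen_def)
  also have "\<dots> = (\<Sum>(k, ks)\<in>{..n} \<times> below xs.
      Poly_Mapping.single (nonzero_parts (k # ks), nonzero_parts (map2 (-) (n # xs) (k # ks))) 1)"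
    by (simp add: sum_product sum.cartesian_product mult_single)
  finally show ?case
    unfolding below_Cons sum.reindex[OF inj] by (simp only: case_prod_unfold comp_def)
qed

lemma lookup_prod_list_sym_coprod_gen:
  "Poly_Mapping.lookup (prod_list (map sym_coprod_gen xs)) (J, K) = real (card (splittings xs J K))"
proof -
  have "Poly_Mapping.lookup (prod_list (map sym_coprod_gen xs)) (J, K) =
      (\<Sum>ks\<in>below xs. if ks \<in> splittings xs J K then 1 else 0)"
    unfolding prod_list_sym_coprod_gen lookup_sum
    by (intro sum.cong) (auto simp: lookup_single splittings_def when_def)
  also have "\<dots> = real (card (splittings xs J K))"
    using finite_below[of xs] by (simp add: sum.If_cases splittings_def Int_def)
  finally show ?thesis .
qed

lemma sym_coprod_gen_0: "sym_coprod_gen 0 = 1"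
proof -
  have "one_part 0 = 0" by transfer simp
  then show ?thesis by (simp add: sym_coprod_gen_def flip: zero_prod_def)
qed

lemma lookup_sym_coprod_S_nonzero_parts:
  "Poly_Mapping.lookup (sym_coprod_S (nonzero_parts xs)) (J, K) = real (card (splittings xs J K))"
proof -
  have "prod_list (map sym_coprod_gen (parts (nonzero_parts xs))) = prod_list (map sym_coprod_gen xs)"
    unfolding nonzero_parts.rep_eq by (induction xs) (simp_all add: sym_coprod_gen_0)
  then show ?thesis by (simp add: sym_coprod_S_def lookup_prod_list_sym_coprod_gen)
qed

lemma lookup_sym_coprod_S:
  "Poly_Mapping.lookup (sym_coprod_S I) (J, K) = real (card (splittings (parts I) J K))"
  using lookup_sym_coprod_S_nonzero_parts[of "parts I"] by (simp add: nonzero_parts_parts)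

section \<open>Counting words by their evaluation\<close>

definition letter_counts :: "nat \<Rightarrow> nat list \<Rightarrow> nat list" where
  "letter_counts t w = map (count_list w) [1..<Suc t]"

lemma length_letter_counts [simp]: "length (letter_counts t w) = t"
  by (simp add: letter_counts_def)

lemma nth_letter_counts: "i < t \<Longrightarrow> letter_counts t w ! i = count_list w (Suc i)"
  by (simp add: letter_counts_def del: upt_Suc)

lemma parts_ev: "parts (ev u) = letter_counts (max_letter (letters u)) (letters u)"
  by (simp add: ev.rep_eq letter_counts_def)

lemma count_list_map_inj_on:
  "inj_on g S \<Longrightarrow> set w \<subseteq> S \<Longrightarrow> b \<in> S \<Longrightarrow> count_list (map g w) (g b) = count_list w b"
  by (induction w) (auto simp: inj_on_def)

lemma map_rank_sorted_list:
  assumes "finite A"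
  shows "map (rank_in A) (sorted_list_of_set A) = [1..<Suc (card A)]"
proof (rule sorted_distinct_set_unique)
  have "sorted_wrt (\<lambda>x y. rank_in A x \<le> rank_in A y) (sorted_list_of_set A)"
    using sorted_sorted_list_of_set[of A] by (rule sorted_wrt_mono_rel[rotated]) (simp add: rank_mono assms)
  then show "sorted (map (rank_in A) (sorted_list_of_set A))"
    by (simp add: sorted_wrt_map)
  show "distinct (map (rank_in A) (sorted_list_of_set A))"
    using inj_on_rank[OF assms] assms by (simp add: distinct_map)
  show "set (map (rank_in A) (sorted_list_of_set A)) = set [1..<Suc (card A)]"
    using assms by (simp add: rank_image atLeastLessThanSuc_atLeastAtMost del: upt_Suc)
qed (simp_all del: upt_Suc)

lemma sorted_list_of_set_filter_upt:
  assumes "A \<subseteq> {a..<b}"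
  shows "sorted_list_of_set A = filter (\<lambda>i. i \<in> A) [a..<b]"
proof (rule sorted_distinct_set_unique)
  have "finite A" using assms finite_subset by blast
  then show "set (sorted_list_of_set A) = set (filter (\<lambda>i. i \<in> A) [a..<b])" using assms by auto
qed (simp_all add: sorted_wrt_filter)

text \<open>
  Packing renames letters monotonically, so it leaves the list of nonzero letter counts unchanged.
\<close>

lemma nonzero_parts_letter_counts:
  assumes "set w \<subseteq> {1..t}" and u: "pack w = letters u"
  shows "nonzero_parts (letter_counts t w) = ev u"
proof -
  have max: "max_letter (letters u) = card (set w)"
    using max_letter_packed[OF set_pack[of w]] u by simp
  have "filter (\<lambda>n. n \<noteq> 0) (letter_counts t w) = map (count_list w) (filter (\<lambda>i. i \<in> set w) [1..<Suc t])"
    by (simp only: letter_counts_def filter_map comp_def count_list_0_iff not_not)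
  also have "filter (\<lambda>i. i \<in> set w) [1..<Suc t] = sorted_list_of_set (set w)"
    using assms(1) by (intro sorted_list_of_set_filter_upt[symmetric]) (auto simp: less_Suc_eq_le)
  also have "map (count_list w) (sorted_list_of_set (set w)) =
      map (count_list (pack w)) (map (rank_in (set w)) (sorted_list_of_set (set w)))"
    using inj_on_rank[of "set w"] by (auto simp: pack_eq_rank count_list_map_inj_on)
  also have "\<dots> = parts (ev u)"
    unfolding parts_ev letter_counts_def map_rank_sorted_list[OF finite_set] max u ..
  finally show ?thesis
    by (simp add: parts_inject[symmetric] nonzero_parts.rep_eq)
qed

lemma letter_counts_append: "letter_counts t (v @ w) = map2 (+) (letter_counts t v) (letter_counts t w)"
  by (rule nth_equalityI) (simp_all add: nth_letter_counts)

lemma letter_counts_eq_imp_set_eq: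
  assumes "letter_counts t v = letter_counts t w" "set v \<subseteq> {1..t}" "set w \<subseteq> {1..t}"
  shows "set v = set w"
proof -
  have "i \<in> set v \<longleftrightarrow> i \<in> set w" if i: "i \<in> {1..t}" for i
  proof -
    obtain j where j: "i = Suc j" "j < t" using i by (cases i) auto
    have "count_list v i = count_list w i"
      using j arg_cong[OF assms(1), of "\<lambda>c. c ! j"] by (simp add: nth_letter_counts)
    then show ?thesis by (metis count_list_0_iff)
  qed
  then show ?thesis using assms(2,3) by blast
qed

text \<open>
  The word \<open>w = w'w''\<close> corresponds to the letter counts of \<open>w'\<close>.  They determine \<open>w\<close>, because they
  and the evaluation give the letter sets of \<open>w'\<close> and \<open>w''\<close>, whose packings are prescribed.
  Conversely, the supports of a splitting and of its complement cover all the letters, since a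
  composition has no zero part, and the corresponding overlay has the required letter counts by
  \<open>nonzero_parts_inject\<close>.
\<close>

lemma card_struct_ev:
  "card {w. wqsym_struct u v w \<noteq> 0 \<and> ev w = I} = card (splittings (parts I) (ev u) (ev v))"
proof (rule bij_betw_same_card[of "\<lambda>w. letter_counts (length (parts I)) (take (length (letters u)) (letters w))"])
  let ?t = "length (parts I)" and ?n = "length (letters u)"
  let ?W = "{w. wqsym_struct u v w \<noteq> 0 \<and> ev w = I}"
  let ?\<phi> = "\<lambda>w. letter_counts ?t (take ?n (letters w))" and ?\<psi> = "\<lambda>w. letter_counts ?t (drop ?n (letters w))"
  have W: "set (take ?n (letters w)) \<subseteq> {1..?t}" "set (drop ?n (letters w)) \<subseteq> {1..?t}"
      "?\<psi> w = map2 (-) (parts I) (?\<phi> w)" "?\<phi> w \<in> below (parts I)"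
    if "w \<in> ?W" for w
  proof -
    have t: "?t = max_letter (letters w)" using that by (auto simp: parts_ev)
    then show "set (take ?n (letters w)) \<subseteq> {1..?t}" "set (drop ?n (letters w)) \<subseteq> {1..?t}"
      using set_letters[of w] set_take_subset set_drop_subset by metis+
    have "parts I = letter_counts ?t (take ?n (letters w) @ drop ?n (letters w))"
      using that t by (auto simp: parts_ev)
    then have I: "parts I = map2 (+) (?\<phi> w) (?\<psi> w)"
      unfolding letter_counts_append .
    show "?\<psi> w = map2 (-) (parts I) (?\<phi> w)"
      by (rule nth_equalityI) (simp, subst I, simp)
    show "?\<phi> w \<in> below (parts I)"
      unfolding below_def mem_Collect_eq by (subst I) (simp add: list_all2_conv_all_nth)
  qed
  show "bij_betw ?\<phi> ?W (splittings (parts I) (ev u) (ev v))"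
  proof (rule bij_betw_imageI)
    show "inj_on ?\<phi> ?W"
    proof (rule inj_onI)
      fix w w' assume w: "w \<in> ?W" and w': "w' \<in> ?W" and eq: "?\<phi> w = ?\<phi> w'"
      have "set (take ?n (letters w)) = set (take ?n (letters w'))"
        using letter_counts_eq_imp_set_eq[OF eq] W(1) w w' by blast
      moreover have "set (drop ?n (letters w)) = set (drop ?n (letters w'))"
        using W(3)[OF w] W(3)[OF w'] eq letter_counts_eq_imp_set_eq[OF _ W(2)[OF w] W(2)[OF w']] by simp
      ultimately have "letters w = letters w'"
        using w w' place_pack append_take_drop_id unfolding struct_nz_iff mem_Collect_eq by metis
      then show "w = w'" by (simp add: letters_inject)
    qed
    show "?\<phi> ` ?W = splittings (parts I) (ev u) (ev v)"
    proof
      show "?\<phi> ` ?W \<subseteq> splittings (parts I) (ev u) (ev v)"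
      proof (rule image_subsetI)
        fix w assume w: "w \<in> ?W"
        then have "nonzero_parts (?\<phi> w) = ev u" "nonzero_parts (?\<psi> w) = ev v"
          using W(1,2)[OF w] by (auto simp: struct_nz_iff intro!: nonzero_parts_letter_counts)
        then show "?\<phi> w \<in> splittings (parts I) (ev u) (ev v)"
          using W(4)[OF w] unfolding W(3)[OF w] by (simp add: splittings_def)
      qed
      show "splittings (parts I) (ev u) (ev v) \<subseteq> ?\<phi> ` ?W"
      proof
        fix ks assume ks: "ks \<in> splittings (parts I) (ev u) (ev v)"
        let ?ls = "map2 (-) (parts I) ks"
        have ks_le: "list_all2 (\<le>) ks (parts I)" and ks_u: "nonzero_parts ks = ev u"
          and ls_v: "nonzero_parts ?ls = ev v"
          using ks by (auto simp: splittings_def below_def)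
        have len: "length ks = ?t" "length ?ls = ?t"
          using list_all2_lengthD[OF ks_le] by simp_all
        \<comment> \<open>Positions in a list are counted from 0, letters from 1.\<close>
        define supp where "supp xs = {i \<in> {1..?t}. xs ! (i - 1) \<noteq> 0}" for xs :: "nat list"
        have card_supp: "card (supp xs) = max_letter (letters z)"
          if "nonzero_parts xs = ev z" "length xs = ?t" for xs z
        proof -
          have "supp xs = Suc ` {i. i < length xs \<and> xs ! i \<noteq> 0}"
            using that(2) by (auto simp: supp_def image_iff Suc_le_eq gr0_conv_Suc)
          then have "card (supp xs) = length (filter (\<lambda>n. n \<noteq> 0) xs)"
            by (simp add: card_image length_filter_conv_card)
          also have "\<dots> = length (parts (ev z))"
            using that(1) by (metis nonzero_parts.rep_eq)
          finally show ?thesis by (simp add: parts_ev)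
        qed
        have pos: "parts I ! i \<noteq> 0" if "i < ?t" for i
          using parts[of I] nth_mem[OF that] by (metis mem_Collect_eq)
        have "supp ks \<union> supp ?ls = {1..?t}"
        proof -
          have "ks ! (i - 1) \<noteq> 0 \<or> ?ls ! (i - 1) \<noteq> 0" if "i \<in> {1..?t}" for i
          proof -
            have i: "i - 1 < ?t" using that by auto
            then have "ks ! (i - 1) \<noteq> 0 \<or> parts I ! (i - 1) - ks ! (i - 1) \<noteq> 0"
              using pos[OF i] by arith
            then show ?thesis using i len by simp
          qed
          then show ?thesis unfolding supp_def by blast
        qed
        then have AB: "(supp ks, supp ?ls) \<in> overlaps (max_letter (letters u)) (max_letter (letters v))"
          using card_supp ks_u ls_v len by (intro overlapsI)
        note O = overlay_overlaps[OF AB]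
        have letter_counts_place: "letter_counts ?t (place (supp xs) (letters z)) = xs"
          if "nonzero_parts xs = ev z" "length xs = ?t" and s: "set (place (supp xs) (letters z)) = supp xs"
            and p: "pack (place (supp xs) (letters z)) = letters z" for xs z
        proof (rule nonzero_parts_inject)
          show "nonzero_parts (letter_counts ?t (place (supp xs) (letters z))) = nonzero_parts xs"
            unfolding that(1)
          proof (rule nonzero_parts_letter_counts[OF _ p])
            show "set (place (supp xs) (letters z)) \<subseteq> {1..?t}"
              unfolding s by (auto simp: supp_def)
          qed
          fix i assume "i < length (letter_counts ?t (place (supp xs) (letters z)))"
          then show "letter_counts ?t (place (supp xs) (letters z)) ! i = 0 \<longleftrightarrow> xs ! i = 0"
            by (simp add: nth_letter_counts count_list_0_iff s) (auto simp: supp_def)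
        qed (simp add: that)
        let ?w = "overlay u v (supp ks, supp ?ls)"
        have cA: "letter_counts ?t (place (supp ks) (letters u)) = ks"
          using O len ks_u by (intro letter_counts_place)
        have cB: "letter_counts ?t (place (supp ?ls) (letters v)) = ?ls"
          using O len ls_v by (intro letter_counts_place)
        have "max_letter (letters ?w) = ?t"
          unfolding O(6) \<open>supp ks \<union> supp ?ls = {1..?t}\<close> by simp
        then have "parts (ev ?w) = map2 (+) ks ?ls"
          by (simp only: parts_ev O(1) letter_counts_append cA cB)
        also have "\<dots> = parts I"
          using ks_le len by (intro nth_equalityI) (auto simp: list_all2_conv_all_nth)
        finally have "ev ?w = I" by (simp add: parts_inject)
        moreover have "wqsym_struct u v ?w \<noteq> 0" by (simp add: struct_nz_iff O)
        moreover have "?\<phi> ?w = ks" by (simp add: O cA)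
        ultimately show "ks \<in> ?\<phi> ` ?W" by (metis (mono_tags, lifting) image_eqI mem_Collect_eq)
      qed
    qed
  qed
qed

section \<open>The multiplicative family of the density\<close>

definition sym_coeff :: "composition \<Rightarrow> composition \<Rightarrow> composition \<Rightarrow> real" where
  "sym_coeff I J K = Poly_Mapping.lookup (sym_coprod_S I) (J, K)"

lemma finite_sym_coeff: "finite {I. sym_coeff I J K \<noteq> 0}"
  unfolding sym_coeff_def by (rule finite_sym_coprod_S)

lemma mset_eq_if_ev_eq: "ev u = ev v \<Longrightarrow> mset (letters u) = mset (letters v)"
proof (rule multiset_eqI)
  fix k assume "ev u = ev v"
  then have c: "letter_counts (max_letter (letters u)) (letters u) = letter_counts (max_letter (letters v)) (letters v)"
    using parts_ev by metis
  then have m: "max_letter (letters u) = max_letter (letters v)"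
    by (metis length_letter_counts)
  show "count (mset (letters u)) k = count (mset (letters v)) k"
  proof (cases "k \<in> {1..max_letter (letters v)}")
    case True
    then obtain j where "k = Suc j" "j < max_letter (letters v)" by (cases k) auto
    then show ?thesis
      using arg_cong[OF c, of "\<lambda>c. c ! j"] m by (simp add: nth_letter_counts count_mset)
  next
    case False
    then have "k \<notin> set (letters u)" "k \<notin> set (letters v)"
      using set_letters[of u] set_letters[of v] m by auto
    then show ?thesis by (simp add: count_mset count_list_0_iff)
  qed
qed

context real_density
begin

lemma m_word_cong: "ev u = ev v \<Longrightarrow> m_word f u = m_word f v"
proof -
  assume "ev u = ev v"
  then have ms: "mset (letters u) = mset (letters v)" by (rule mset_eq_if_ev_eq)
  then have "max_letter (letters u) = max_letter (letters v)"
    by (metis max_letter_def set_mset_mset)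
  then show ?thesis by (simp add: m_word_eq_prob prob_seq_cone_permute[OF ms])
qed

lemma m_comp_ev: "m_comp f (ev u) = m_word f u"
  unfolding m_comp_def by (rule the_equality) (auto intro: m_word_cong)

text \<open>
  The rule \<open>m_word_mult\<close>, with its terms grouped by the evaluation of \<open>w\<close>.
\<close>

lemma m_comp_mult:
  "Sum_any (\<lambda>I. m_comp f I * sym_coeff I J K) = m_comp f J * m_comp f K"
proof -
  obtain u v where uv: "ev u = J" "ev v = K" using surj_ev by (metis surjD)
  let ?W = "{w. wqsym_struct u v w \<noteq> 0}"
  have fin: "finite ?W" by (rule finite_wqsym_struct)
  have card: "sym_coeff I J K = real (card {w \<in> ?W. ev w = I})" for I
    using card_struct_ev[of u v I] uv by (simp add: sym_coeff_def lookup_sym_coprod_S)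
  have "Sum_any (\<lambda>I. m_comp f I * sym_coeff I J K) = (\<Sum>I\<in>ev ` ?W. m_comp f I * sym_coeff I J K)"
  proof (rule Sum_any.expand_superset)
    show "{I. m_comp f I * sym_coeff I J K \<noteq> 0} \<subseteq> ev ` ?W"
    proof
      fix I assume "I \<in> {I. m_comp f I * sym_coeff I J K \<noteq> 0}"
      then have "card {w \<in> ?W. ev w = I} \<noteq> 0" by (simp add: card)
      then have "{w \<in> ?W. ev w = I} \<noteq> {}" by (metis card.empty)
      then show "I \<in> ev ` ?W" by blast
    qed
  qed (use fin in simp)
  also have "\<dots> = (\<Sum>I\<in>ev ` ?W. \<Sum>w\<in>{w \<in> ?W. ev w = I}. m_word f w)"
  proof (rule sum.cong[OF refl])
    fix I
    have "(\<Sum>w\<in>{w \<in> ?W. ev w = I}. m_word f w) = (\<Sum>w\<in>{w \<in> ?W. ev w = I}. m_comp f I)"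
      by (intro sum.cong) (auto simp: m_comp_ev)
    then show "m_comp f I * sym_coeff I J K = (\<Sum>w\<in>{w \<in> ?W. ev w = I}. m_word f w)"
      by (simp add: card)
  qed
  also have "\<dots> = (\<Sum>w\<in>?W. m_word f w)"
    by (rule sum.image_gen[symmetric]) (rule fin)
  also have "\<dots> = m_comp f J * m_comp f K"
    using m_word_mult[of u v] m_comp_ev uv by metis
  finally show ?thesis .
qed

lemma m_word_empty: "m_word f empty_word = 1"
  using P.prob_space by (simp add: m_word_eq_prob empty_word.rep_eq seq_cone_def max_letter_def)

lemma ev_empty_word: "ev empty_word = 0"
  by transfer (simp add: max_letter_def)

lemma m_comp_0: "m_comp f 0 = 1"
  using m_comp_ev[of empty_word] by (simp add: ev_empty_word m_word_empty)

lemma wqsym_series_eq: "wqsym_series f = m_word f"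
proof
  fix v
  have "wqsym_series f v = Sum_any (\<lambda>u. if u = v then m_word f v else 0)"
    unfolding wqsym_series_def formal_sum_def wqsym_N_def by (intro Sum_any.cong) auto
  then show "wqsym_series f v = m_word f v" by simp
qed

lemma sym_series_eq: "sym_series f = m_comp f"
proof
  fix J
  have "sym_series f J = Sum_any (\<lambda>I. if I = J then m_comp f J else 0)"
    unfolding sym_series_def formal_sum_def sym_S_comp_eq
    by (intro Sum_any.cong) (auto simp: lookup_single when_def)
  then show "sym_series f J = m_comp f J" by simp
qed

lemma grouplike_wqsym: "grouplike wqsym_coprod empty_word (wqsym_series f)"
proof -
  have "wqsym_coprod (m_word f) (u, v) = m_word f u * m_word f v" for u v
  proof -
    have "wqsym_coprod (m_word f) (u, v) = Sum_any (\<lambda>w. m_word f w * wqsym_struct u v w)"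
      by (simp add: wqsym_coprod_def formal_sum_def wqsym_coprod_N_def)
    also have "\<dots> = (\<Sum>w | wqsym_struct u v w \<noteq> 0. m_word f w * wqsym_struct u v w)"
      using finite_wqsym_struct by (intro Sum_any.expand_superset) auto
    also have "\<dots> = (\<Sum>w | wqsym_struct u v w \<noteq> 0. m_word f w)"
      by (intro sum.cong) (auto simp: wqsym_struct_def split: if_splits)
    finally show ?thesis by (simp add: m_word_mult)
  qed
  then show ?thesis
    by (auto simp: grouplike_def wqsym_series_eq m_word_empty tensor_def)
qed

lemma grouplike_sym: "grouplike sym_coprod 0 (sym_series f)"
  using m_comp_mult m_comp_0
  by (auto simp: grouplike_def sym_series_eq sym_coprod_def formal_sum_def tensor_def sym_coeff_def)

end

section \<open>Characters of quasi-symmetric functions\<close>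

definition exponents :: "(nat \<Rightarrow>\<^sub>0 nat) \<Rightarrow> composition" where
  "exponents m = nonzero_parts (map (Poly_Mapping.lookup m) (sorted_list_of_set (Poly_Mapping.keys m)))"

lemma parts_exponents:
  "parts (exponents m) = map (Poly_Mapping.lookup m) (sorted_list_of_set (Poly_Mapping.keys m))"
  unfolding exponents_def nonzero_parts.rep_eq
  by (rule filter_True) (simp add: in_keys_iff)

lemma exponents_eq:
  assumes "Poly_Mapping.keys m \<subseteq> {..<N}"
  shows "exponents m = nonzero_parts (map (Poly_Mapping.lookup m) [0..<N])"
proof -
  have *: "Poly_Mapping.keys m \<subseteq> {0..<N}" using assms by auto
  have "parts (nonzero_parts (map (Poly_Mapping.lookup m) [0..<N])) =
      map (Poly_Mapping.lookup m) (filter (\<lambda>i. i \<in> Poly_Mapping.keys m) [0..<N])"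
    by (simp only: nonzero_parts.rep_eq filter_map comp_def in_keys_iff)
  also have "\<dots> = parts (exponents m)"
    unfolding parts_exponents sorted_list_of_set_filter_upt[OF *] ..
  finally show ?thesis by (simp only: parts_inject)
qed

text \<open>
  A sequence \<open>k\<^sub>1 < \<dots> < k\<^sub>r\<close> that produces \<open>m\<close> must list the variables of \<open>m\<close> in order, since all
  parts of \<open>I\<close> are nonzero.
\<close>

lemma qsym_M_eq: "qsym_M I m = of_bool (exponents m = I)"
proof -
  let ?ss = "sorted_list_of_set (Poly_Mapping.keys m)"
  let ?sum = "\<lambda>ks :: nat list. \<Sum>j<length ks. Poly_Mapping.single (ks ! j) (parts I ! j)"
  let ?K = "{ks. length ks = length (parts I) \<and> sorted_wrt (<) ks \<and> m = ?sum ks}"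
  have lookup: "Poly_Mapping.lookup (?sum ks) i = (\<Sum>j<length ks. if ks ! j = i then parts I ! j else 0)"
    for ks :: "nat list" and i
    by (simp add: lookup_sum lookup_single when_def)
  have lookup_nth: "Poly_Mapping.lookup (?sum ks) (ks ! l) = parts I ! l"
    if "sorted_wrt (<) ks" "l < length ks" for ks :: "nat list" and l
  proof -
    have d: "distinct ks" using that(1) by (simp add: strict_sorted_iff)
    have "(\<Sum>j<length ks. if ks ! j = ks ! l then parts I ! j else 0) =
        (\<Sum>j<length ks. if j = l then parts I ! j else 0)"
      using nth_eq_iff_index_eq[OF d] that(2) by (intro sum.cong) auto
    then show ?thesis using that(2) by (simp add: lookup)
  qed
  have not_in: "Poly_Mapping.lookup (?sum ks) i = 0" if "i \<notin> set ks" for ks i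
    unfolding lookup using that by (intro sum.neutral) auto
  have pos: "parts I ! i \<noteq> 0" if "i < length (parts I)" for i
    using parts[of I] nth_mem[OF that] by (metis mem_Collect_eq)
  have "?K = (if exponents m = I then {?ss} else {})"
  proof -
    have K: "ks = ?ss \<and> exponents m = I" if ks: "ks \<in> ?K" for ks
    proof
      have len: "length ks = length (parts I)" and sorted: "sorted_wrt (<) ks" and m: "m = ?sum ks"
        using ks by auto
      have lookup_m: "Poly_Mapping.lookup m (ks ! l) = parts I ! l" if "l < length ks" for l
        unfolding m by (rule lookup_nth[OF sorted that])
      have keys: "Poly_Mapping.keys m = set ks"
      proof (intro set_eqI iffI)
        fix i assume "i \<in> Poly_Mapping.keys m"
        then show "i \<in> set ks" using not_in[of i ks] m by (metis in_keys_iff)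
      next
        fix i assume "i \<in> set ks"
        then obtain l where "l < length ks" "i = ks ! l" by (metis in_set_conv_nth)
        then show "i \<in> Poly_Mapping.keys m"
          using lookup_m pos len by (simp add: in_keys_iff)
      qed
      show ss: "ks = ?ss"
        unfolding keys using sorted
        by (metis sorted_list_of_set.idem_if_sorted_distinct strict_sorted_iff)
      have "map (Poly_Mapping.lookup m) ks = parts I"
        using len lookup_m by (intro nth_equalityI) simp_all
      then show "exponents m = I"
        using ss parts_exponents[of m] by (simp add: parts_inject)
    qed
    have ss: "?ss \<in> ?K" if "exponents m = I"
    proof -
      have p: "parts I = map (Poly_Mapping.lookup m) ?ss"
        using that parts_exponents by metis
      then have len: "length ?ss = length (parts I)" by simp
      have sorted: "sorted_wrt (<) ?ss" by simp
      have "m = ?sum ?ss"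
      proof (rule poly_mapping_eqI)
        fix i
        show "Poly_Mapping.lookup m i = Poly_Mapping.lookup (?sum ?ss) i"
        proof (cases "i \<in> Poly_Mapping.keys m")
          case True
          then obtain l where "l < length ?ss" "?ss ! l = i"
            by (metis finite_keys in_set_conv_nth set_sorted_list_of_set)
          then show ?thesis using lookup_nth[OF sorted] p by (metis nth_map)
        next
          case False
          then show ?thesis using not_in[of i ?ss] by (simp add: in_keys_iff)
        qed
      qed
      then show ?thesis using len sorted by simp
    qed
    show ?thesis
    proof (cases "exponents m = I")
      case True
      then have "?K = {?ss}" using K ss by blast
      with True show ?thesis by simp
    next
      case False
      then have "?K = {}" using K by blast
      with False show ?thesis by simp
    qed
  qed
  then show ?thesis unfolding qsym_M_def by simp
qed

text \<open>
  A monomial that occurs in \<open>M\<^sub>I\<close> and in no other \<open>M\<^sub>J\<close>; evaluating a quasi-symmetric function there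
  extracts its coordinate on \<open>M\<^sub>I\<close>.
\<close>

definition monomial :: "composition \<Rightarrow> nat \<Rightarrow>\<^sub>0 nat" where
  "monomial I = Poly_Mapping.nth (parts I)"

lemma exponents_monomial: "exponents (monomial I) = I"
proof -
  have "Poly_Mapping.keys (monomial I) \<subseteq> {..<length (parts I)}"
    by (auto simp: monomial_def in_keys_iff nth_default_def simp del: keys_nth split: if_splits)
  then have "exponents (monomial I) =
      nonzero_parts (map (nth_default 0 (parts I)) [0..<length (parts I)])"
    by (simp add: exponents_eq monomial_def)
  also have "map (nth_default 0 (parts I)) [0..<length (parts I)] = parts I"
    by (rule nth_equalityI) (simp_all add: nth_default_def)
  finally show ?thesis by (simp add: nonzero_parts_parts)
qed

text \<open>
  The exponent list of \<open>a\<close>, in a range of variables containing those of \<open>m\<close>, is a splitting of the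
  exponent list of \<open>m\<close>, the complement being the exponent list of \<open>b\<close>.
\<close>

lemma card_factorizations:
  "card {(a, b). a + b = m \<and> exponents a = J \<and> exponents b = K} = sym_coeff (exponents m) J K"
proof -
  obtain N where N: "Poly_Mapping.keys m \<subseteq> {..<N}"
    using finite_nat_iff_bounded[of "Poly_Mapping.keys m"] by auto
  let ?v = "\<lambda>a. map (Poly_Mapping.lookup a) [0..<N]"
  let ?P = "{(a, b). a + b = m \<and> exponents a = J \<and> exponents b = K}"
  have P: "Poly_Mapping.keys a \<subseteq> {..<N}" "Poly_Mapping.keys b \<subseteq> {..<N}"
      "?v b = map2 (-) (?v m) (?v a)" "?v a \<in> below (?v m)" if "a + b = m" for a b
  proof -
    have l: "Poly_Mapping.lookup m i = Poly_Mapping.lookup a i + Poly_Mapping.lookup b i" for i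
      using that by (simp add: lookup_add flip: that)
    show "Poly_Mapping.keys a \<subseteq> {..<N}" "Poly_Mapping.keys b \<subseteq> {..<N}"
      using N l by (auto simp: in_keys_iff subset_iff)
    show "?v b = map2 (-) (?v m) (?v a)"
      by (rule nth_equalityI) (simp_all add: l)
    show "?v a \<in> below (?v m)"
      by (simp add: below_def list_all2_conv_all_nth l)
  qed
  have "bij_betw (\<lambda>(a, b). ?v a) ?P (splittings (?v m) J K)"
  proof (rule bij_betw_imageI)
    show "inj_on (\<lambda>(a, b). ?v a) ?P"
    proof (rule inj_onI, clarify)
      fix a b a' b' assume eq: "?v a = ?v a'" and m: "m = a + b" "a' + b' = a + b"
      have "a = a'"
      proof (rule poly_mapping_eqI)
        fix i
        have "Poly_Mapping.keys a \<subseteq> {..<N}" "Poly_Mapping.keys a' \<subseteq> {..<N}"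
          using P(1)[of a b] P(1)[of a' b'] m by simp_all
        then show "Poly_Mapping.lookup a i = Poly_Mapping.lookup a' i"
          using eq by (cases "i < N") (simp, metis in_keys_iff lessThan_iff subsetD)
      qed
      then show "a = a' \<and> b = b'" using m by simp
    qed
    show "(\<lambda>(a, b). ?v a) ` ?P = splittings (?v m) J K"
    proof
      show "(\<lambda>(a, b). ?v a) ` ?P \<subseteq> splittings (?v m) J K"
      proof (rule image_subsetI, clarify)
        fix a b assume "m = a + b" "J = exponents a" "K = exponents b"
        then show "?v a \<in> splittings (?v (a + b)) (exponents a) (exponents b)"
          using P(3)[of a b] P(4)[of a b] exponents_eq[OF P(1)[of a b]] exponents_eq[OF P(2)[of a b]]
          by (simp only: splittings_def mem_Collect_eq simp_thms)
      qed
      show "splittings (?v m) J K \<subseteq> (\<lambda>(a, b). ?v a) ` ?P"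
      proof
        fix ks assume ks: "ks \<in> splittings (?v m) J K"
        then have le: "list_all2 (\<le>) ks (?v m)" by (simp add: splittings_def below_def)
        then have len: "length ks = N" using list_all2_lengthD by fastforce
        let ?a = "Poly_Mapping.nth ks" and ?b = "m - Poly_Mapping.nth ks"
        have le': "Poly_Mapping.lookup ?a i \<le> Poly_Mapping.lookup m i" for i
          using le len by (cases "i < N") (auto simp: list_all2_conv_all_nth nth_default_def)
        have m: "?a + ?b = m"
          using le' by (intro poly_mapping_eqI) (simp add: lookup_add lookup_minus)
        have va: "?v ?a = ks"
          using len by (intro nth_equalityI) (simp_all add: nth_default_def)
        have "exponents ?a = J" "exponents ?b = K"
          using ks P(3)[OF m] unfolding splittings_def exponents_eq[OF P(1)[OF m]]
            exponents_eq[OF P(2)[OF m]] va by simp_all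
        then have "(?a, ?b) \<in> ?P" using m by simp
        then show "ks \<in> (\<lambda>(a, b). ?v a) ` ?P" using va by (metis (mono_tags, lifting) case_prod_conv image_eqI)
      qed
    qed
  qed
  then have "card ?P = card (splittings (?v m) J K)" by (rule bij_betw_same_card)
  then show ?thesis
    by (simp add: sym_coeff_def exponents_eq[OF N] lookup_sym_coprod_S_nonzero_parts)
qed

lemma QSym_cases:
  assumes "F \<in> QSym"
  obtains c :: "composition \<Rightarrow>\<^sub>0 real" where "F = (\<lambda>m. Poly_Mapping.lookup c (exponents m))"
proof -
  obtain c :: "composition \<Rightarrow>\<^sub>0 real"
    where F: "F = (\<lambda>m. \<Sum>I\<in>Poly_Mapping.keys c. Poly_Mapping.lookup c I * qsym_M I m)"
    using assms unfolding QSym_def by auto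
  have "F = (\<lambda>m. Poly_Mapping.lookup c (exponents m))"
  proof
    fix m
    have "F m = (\<Sum>I\<in>Poly_Mapping.keys c. if exponents m = I then Poly_Mapping.lookup c I else 0)"
      unfolding F by (intro sum.cong) (auto simp: qsym_M_eq)
    also have "\<dots> = Poly_Mapping.lookup c (exponents m)"
      by (simp add: in_keys_iff)
    finally show "F m = Poly_Mapping.lookup c (exponents m)" .
  qed
  then show thesis by (rule that)
qed

text \<open>
  The product of \<open>\<Sum>\<^sub>J c\<^sub>J M\<^sub>J\<close> and \<open>\<Sum>\<^sub>K d\<^sub>K M\<^sub>K\<close>, with the factorizations of \<open>m\<close> grouped by the
  exponents of the two factors.
\<close>

lemma ps_mult_exponents:
  fixes c d :: "composition \<Rightarrow>\<^sub>0 real"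
  shows "ps_mult (\<lambda>m. Poly_Mapping.lookup c (exponents m)) (\<lambda>m. Poly_Mapping.lookup d (exponents m)) m =
    (\<Sum>J\<in>Poly_Mapping.keys c. \<Sum>K\<in>Poly_Mapping.keys d.
       Poly_Mapping.lookup c J * Poly_Mapping.lookup d K * sym_coeff (exponents m) J K)"
proof -
  let ?c = "Poly_Mapping.lookup c" and ?d = "Poly_Mapping.lookup d"
  let ?X = "Poly_Mapping.keys c \<times> Poly_Mapping.keys d"
  let ?P = "{(a, b). a + b = m}"
  let ?e = "\<lambda>(a, b). (exponents a, exponents b)"
  have fin: "finite ?P" by (rule finite_ps_mult)
  have "(\<Sum>p\<in>?P. case ?e p of (J, K) \<Rightarrow> ?c J * ?d K) =
      (\<Sum>p\<in>?P. \<Sum>X\<in>?X. if X = ?e p then (case X of (J, K) \<Rightarrow> ?c J * ?d K) else 0)"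
    by (intro sum.cong refl) (auto simp: in_keys_iff split: prod.split)
  also have "\<dots> = (\<Sum>X\<in>?X. \<Sum>p\<in>?P. if X = ?e p then (case X of (J, K) \<Rightarrow> ?c J * ?d K) else 0)"
    by (rule sum.swap)
  also have "\<dots> = (\<Sum>(J, K)\<in>?X. ?c J * ?d K * sym_coeff (exponents m) J K)"
  proof (intro sum.cong refl, clarify)
    fix J K
    have "{p \<in> ?P. (J, K) = ?e p} = {(a, b). a + b = m \<and> exponents a = J \<and> exponents b = K}"
      by auto
    then show "(\<Sum>p\<in>?P. if (J, K) = ?e p then ?c J * ?d K else 0) =
        ?c J * ?d K * sym_coeff (exponents m) J K"
      using fin card_factorizations[of m J K] by (simp add: sum.inter_filter[symmetric])
  qed
  finally show ?thesis
    by (simp add: ps_mult_def sum.cartesian_product case_prod_unfold)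
qed

text \<open>
  The linear extension of \<open>M\<^sub>I \<mapsto> h I\<close> from the basis to \<open>QSym\<close>.
\<close>

definition qsym_functional :: "(composition \<Rightarrow> real) \<Rightarrow> power_series \<Rightarrow> real" where
  "qsym_functional h F = Sum_any (\<lambda>I. h I * F (monomial I))"

lemma qsym_functional_M: "qsym_functional h (qsym_M I) = h I"
proof -
  have "qsym_functional h (qsym_M I) = Sum_any (\<lambda>J. if J = I then h J else 0)"
    unfolding qsym_functional_def
    by (intro Sum_any.cong) (simp add: qsym_M_eq exponents_monomial)
  then show ?thesis by simp
qed

lemma ps_one_eq: "ps_one = qsym_M 0"
proof
  fix m
  have "exponents m = 0 \<longleftrightarrow> m = 0"
    by (simp add: parts_inject[symmetric] parts_exponents zero_composition.rep_eq)
  then show "ps_one m = qsym_M 0 m" by (simp add: ps_one_def qsym_M_eq)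
qed

lemma finite_QSym_support:
  assumes "F \<in> QSym"
  shows "finite {I. h I * F (monomial I) \<noteq> 0}"
proof -
  obtain c :: "composition \<Rightarrow>\<^sub>0 real" where "F = (\<lambda>m. Poly_Mapping.lookup c (exponents m))"
    using QSym_cases[OF assms] .
  then have "{I. h I * F (monomial I) \<noteq> 0} \<subseteq> Poly_Mapping.keys c"
    by (auto simp: exponents_monomial in_keys_iff)
  then show ?thesis by (rule finite_subset) simp
qed

lemma Sum_any_sum:
  assumes "finite A" and "\<And>a. a \<in> A \<Longrightarrow> finite {b. g a b \<noteq> 0}"
  shows "Sum_any (\<lambda>b. \<Sum>a\<in>A. g a b) = (\<Sum>a\<in>A. Sum_any (g a))"
proof -
  let ?B = "\<Union>a\<in>A. {b. g a b \<noteq> 0}"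
  have fin: "finite ?B" using assms by blast
  have "Sum_any (\<lambda>b. \<Sum>a\<in>A. g a b) = (\<Sum>b\<in>?B. \<Sum>a\<in>A. g a b)"
    using fin by (rule Sum_any.expand_superset) (auto dest: sum.not_neutral_contains_not_neutral)
  also have "\<dots> = (\<Sum>a\<in>A. \<Sum>b\<in>?B. g a b)" by (rule sum.swap)
  also have "\<dots> = (\<Sum>a\<in>A. Sum_any (g a))"
    using fin by (intro sum.cong refl Sum_any.expand_superset[symmetric]) auto
  finally show ?thesis .
qed

lemma qsym_functional_lookup:
  fixes c :: "composition \<Rightarrow>\<^sub>0 real"
  shows "qsym_functional h (\<lambda>m. Poly_Mapping.lookup c (exponents m)) =
    (\<Sum>J\<in>Poly_Mapping.keys c. Poly_Mapping.lookup c J * h J)"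
  unfolding qsym_functional_def exponents_monomial
  by (subst Sum_any.expand_superset[of "Poly_Mapping.keys c"]) (auto simp: in_keys_iff mult.commute)

text \<open>
  The coproduct of \<open>Sym\<close> and the product of \<open>QSym\<close> have the same structure constants, so a grouplike
  family defines a character.
\<close>

lemma qsym_character_functional:
  assumes one: "h 0 = 1"
    and mult: "\<And>J K. Sum_any (\<lambda>I. h I * sym_coeff I J K) = h J * h K"
  shows "qsym_character (qsym_functional h)"
  unfolding qsym_character_def
proof (intro conjI ballI allI)
  fix F G assume F: "F \<in> QSym" and G: "G \<in> QSym"
  show "qsym_functional h (\<lambda>m. F m + G m) = qsym_functional h F + qsym_functional h G"
    unfolding qsym_functional_def distrib_left
    by (rule Sum_any.distrib) (intro finite_QSym_support F G)+
  obtain c :: "composition \<Rightarrow>\<^sub>0 real" where c: "F = (\<lambda>m. Poly_Mapping.lookup c (exponents m))"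
    using QSym_cases[OF F] .
  obtain d :: "composition \<Rightarrow>\<^sub>0 real" where d: "G = (\<lambda>m. Poly_Mapping.lookup d (exponents m))"
    using QSym_cases[OF G] .
  let ?c = "Poly_Mapping.lookup c" and ?d = "Poly_Mapping.lookup d"
  have fin: "finite {I. h I * (x * sym_coeff I J K) \<noteq> 0}" for x J K
    by (rule finite_subset[OF _ finite_sym_coeff[of J K]]) auto
  have fin': "finite {I. h I * sym_coeff I J K \<noteq> 0}" for J K
    by (rule finite_subset[OF _ finite_sym_coeff[of J K]]) auto
  have "qsym_functional h (ps_mult F G) = Sum_any (\<lambda>I. \<Sum>(J, K)\<in>Poly_Mapping.keys c \<times> Poly_Mapping.keys d.
      h I * (?c J * ?d K * sym_coeff I J K))"
    unfolding qsym_functional_def c d ps_mult_exponents exponents_monomial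
    by (simp add: sum.cartesian_product sum_distrib_left case_prod_unfold)
  also have "\<dots> = (\<Sum>(J, K)\<in>Poly_Mapping.keys c \<times> Poly_Mapping.keys d.
      Sum_any (\<lambda>I. h I * (?c J * ?d K * sym_coeff I J K)))"
    unfolding case_prod_unfold by (rule Sum_any_sum[OF _ fin]) simp
  also have "\<dots> = (\<Sum>(J, K)\<in>Poly_Mapping.keys c \<times> Poly_Mapping.keys d. ?c J * h J * (?d K * h K))"
  proof (intro sum.cong refl, clarify)
    fix J K
    have "Sum_any (\<lambda>I. h I * (?c J * ?d K * sym_coeff I J K)) =
        Sum_any (\<lambda>I. ?c J * ?d K * (h I * sym_coeff I J K))"
      by (simp add: mult_ac)
    also have "\<dots> = ?c J * ?d K * Sum_any (\<lambda>I. h I * sym_coeff I J K)"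
      using fin' by (rule Sum_any_right_distrib[symmetric])
    finally show "Sum_any (\<lambda>I. h I * (?c J * ?d K * sym_coeff I J K)) = ?c J * h J * (?d K * h K)"
      by (simp add: mult)
  qed
  also have "\<dots> = qsym_functional h F * qsym_functional h G"
    unfolding c d qsym_functional_lookup sum_product sum.cartesian_product ..
  finally show "qsym_functional h (ps_mult F G) = qsym_functional h F * qsym_functional h G" .
next
  fix a F assume "F \<in> QSym"
  from finite_QSym_support[OF this, of h]
  show "qsym_functional h (\<lambda>m. a * F m) = a * qsym_functional h F"
    unfolding qsym_functional_def by (subst Sum_any_right_distrib) (simp_all add: mult_ac)
next
  show "qsym_functional h ps_one = 1"
    by (simp add: ps_one_eq qsym_functional_M one)
qed

section \<open>The series attached to a density\<close>

theorem corollary5p3: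
  fixes f :: "real \<Rightarrow> real"
  assumes "\<And>x. 0 \<le> f x"
    and "has_bochner_integral lborel f 1"
  shows "(\<forall>u v. ev u = ev v \<longrightarrow> m_word f u = m_word f v)
    \<and> grouplike wqsym_coprod empty_word (wqsym_series f)
    \<and> wqsym_series f = sym_embed (sym_series f)
    \<and> grouplike sym_coprod 0 (sym_series f)
    \<and> (\<exists>\<psi>. qsym_character \<psi> \<and> (\<forall>I. m_comp f I = \<psi> (qsym_M I)))"
proof -
  interpret real_density f by unfold_locales fact+
  have "qsym_character (qsym_functional (m_comp f))"
    by (rule qsym_character_functional[OF m_comp_0 m_comp_mult])
  moreover have "m_comp f I = qsym_functional (m_comp f) (qsym_M I)" for I
    by (rule qsym_functional_M[symmetric])
  moreover have "wqsym_series f = sym_embed (sym_series f)"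
    by (rule ext) (simp add: wqsym_series_eq sym_series_eq sym_embed_eq m_comp_ev)
  ultimately show ?thesis
    using m_word_cong grouplike_wqsym grouplike_sym by blast
qed

end
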